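(* Let $\beta\in\mathbb R$. (1) Let $1<p<\infty$ and $\Omega\subset\mathbb R^{2n+1}$ open; if $2n+\beta<0$ assume also $\Omega\subset(\mathbb R^{2n}\setminus\{0\})\times\mathbb R$. Then for every $u\in C^1_0(\Omega)$, $$\Big(\frac{|2n+\beta|}{p}\Big)^p\int_\Omega|u|^pr^\beta d\xi\le\int_\Omega|\nabla_Lu|^pr^{p+\beta}d\xi,$$ and in particular $\big(\frac{|2n-p|}{p}\big)^p\int_\Omega\frac{|u|^p}{N^p}d\xi\le\big(\frac{|2n-p|}{p}\big)^p\int_\Omega\frac{|u|^p}{r^p}d\xi\le\int_\Omega|\nabla_Lu|^pd\xi$. If $(B^{2n}_\rho\setminus\{0\})\times B^1_\rho\subset\Omega$ for some $\rho>0$, the constant $(|2n+\beta|/p)^p$ is sharp. (2) Let $p=2n$, $R>0$, $\Omega=\{(x,y,t):|(x,y)|<R\}$, $\beta<-1$. Then for every $u\in C^1_0(\Omega)$, $$\Big(\frac{|\beta+1|}{p}\Big)^p\int_\Omega\frac{|u|^p}{r^p}\Big(\ln\frac Rr\Big)^\beta d\xi\le\int_\Omega|\nabla_Lu|^p\Big(\ln\frac Rr\Big)^{p+\beta}d\xi,$$ in particular $\big(\frac{p-1}{p}\big)^p\int_\Omega\frac{|u|^p}{(r\ln(R/r))^p}d\xi\le\int_\Omega|\nabla_Lu|^pd\xi$; the constant $(|\beta+1|/p)^p$ is sharp.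
   Context: Let $\xi=(x,y,t)\in\mathbb R^n\times\mathbb R^n\times\mathbb R$, $r=|(x,y)|$, $\gamma\ge1$. The Heisenberg–Greiner vector fields are $X_i=\partial_{x_i}+2\gamma y_ir^{2\gamma-2}\partial_t$, $Y_i=\partial_{y_i}-2\gamma x_ir^{2\gamma-2}\partial_t$, and $\nabla_L=(X_1,\dots,X_n,Y_1,\dots,Y_n)$. $N(x,y,t)=(r^{4\gamma}+t^2)^{1/(4\gamma)}$. $B^s_\rho$ is the Euclidean ball in $\mathbb R^s$ of radius $\rho$ centred at the origin. "Sharp" means the constant cannot be replaced by any larger one. *)

theory Defs
  imports "HOL-Analysis.Analysis"
begin

type_synonym 'n pt = "(real^'n) \<times> (real^'n) \<times> real"

definition xc :: "'n pt \<Rightarrow> real^'n" where "xc \<xi> = fst \<xi>"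
definition yc :: "'n pt \<Rightarrow> real^'n" where "yc \<xi> = fst (snd \<xi>)"
definition tc :: "'n pt \<Rightarrow> real" where "tc \<xi> = snd (snd \<xi>)"

definition rr :: "('n::finite) pt \<Rightarrow> real" where
  "rr \<xi> = sqrt ((norm (xc \<xi>))\<^sup>2 + (norm (yc \<xi>))\<^sup>2)"

definition NN :: "real \<Rightarrow> ('n::finite) pt \<Rightarrow> real" where
  "NN \<gamma> \<xi> = (rr \<xi> powr (4*\<gamma>) + (tc \<xi>)\<^sup>2) powr (1 / (4*\<gamma>))"

definition C1_0 :: "('n::finite) pt set \<Rightarrow> ('n pt \<Rightarrow> real) set" where
  "C1_0 \<Omega> = {u. (\<exists>D. (\<forall>\<xi>\<in>\<Omega>. (u has_derivative D \<xi>) (at \<xi>))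
                      \<and> (\<forall>v. continuous_on \<Omega> (\<lambda>\<xi>. D \<xi> v)))
               \<and> compact (closure {\<xi>. u \<xi> \<noteq> 0})
               \<and> closure {\<xi>. u \<xi> \<noteq> 0} \<subseteq> \<Omega>}"

definition dx :: "(('n::finite) pt \<Rightarrow> real) \<Rightarrow> 'n \<Rightarrow> 'n pt \<Rightarrow> real" where
  "dx u i \<xi> = frechet_derivative u (at \<xi>) (axis i 1, 0, 0)"
definition dy :: "(('n::finite) pt \<Rightarrow> real) \<Rightarrow> 'n \<Rightarrow> 'n pt \<Rightarrow> real" where
  "dy u i \<xi> = frechet_derivative u (at \<xi>) (0, axis i 1, 0)"
definition dt :: "(('n::finite) pt \<Rightarrow> real) \<Rightarrow> 'n pt \<Rightarrow> real" where
  "dt u \<xi> = frechet_derivative u (at \<xi>) (0, 0, 1)"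

text \<open>Heisenberg-Greiner vector fields X_i, Y_i (parameter gamma).\<close>
definition XX :: "real \<Rightarrow> (('n::finite) pt \<Rightarrow> real) \<Rightarrow> 'n \<Rightarrow> 'n pt \<Rightarrow> real" where
  "XX \<gamma> u i \<xi> = dx u i \<xi> + 2*\<gamma> * (yc \<xi> $ i) * rr \<xi> powr (2*\<gamma> - 2) * dt u \<xi>"
definition YY :: "real \<Rightarrow> (('n::finite) pt \<Rightarrow> real) \<Rightarrow> 'n \<Rightarrow> 'n pt \<Rightarrow> real" where
  "YY \<gamma> u i \<xi> = dy u i \<xi> - 2*\<gamma> * (xc \<xi> $ i) * rr \<xi> powr (2*\<gamma> - 2) * dt u \<xi>"

definition gradL_norm :: "real \<Rightarrow> (('n::finite) pt \<Rightarrow> real) \<Rightarrow> 'n pt \<Rightarrow> real" where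
  "gradL_norm \<gamma> u \<xi> = sqrt (\<Sum>i\<in>UNIV. (XX \<gamma> u i \<xi>)\<^sup>2 + (YY \<gamma> u i \<xi>)\<^sup>2)"

end

theory Submission
  imports Defs "HOL-Real_Asymp.Real_Asymp"
begin

text \<open>The horizontal gradient controls the derivative of \<open>u\<close> along the dilations
  \<open>(x, y, t) \<mapsto> (l x, l y, t)\<close>: it equals \<open>\<Sum> x\<^sub>i X\<^sub>i u + y\<^sub>i Y\<^sub>i u\<close>, which is at most
  \<open>r \<bar>\<nabla>\<^sub>L u\<bar>\<close>. Integrating over the orbits reduces both inequalities to weighted Hardy inequalities on
  the line in the variable \<open>s = ln r\<close>, which follow from Young's inequality and the fundamental theorem
  of calculus. For sharpness, products \<open>f (ln r) \<psi> (t)\<close> concentrating at the axis make the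
  \<open>t\<close>-derivative negligible, because it enters the gradient with a factor \<open>r\<close> to the power
  \<open>2\<gamma> - 1\<close> instead of \<open>- 1\<close>.\<close>

section \<open>Weighted Hardy inequalities on the line\<close>

text \<open>The obstacle is the axis r = 0: the weights may be singular there, and the support of
  \<open>u\<close> may reach it. The sign of an exponent \<open>d\<close> decides whether this
  matters. Both weights have the form exp (p d \<tau>) against d\<tau>, and integration by parts
  leaves one boundary term. For d \<ge> 0 its inner part has the favourable sign, so
  \<open>u\<close> only has to vanish at the outer end of an orbit, as it does by compactness of the
  support. For d < 0 the ends exchange roles; hence the support must avoid the axis when 2n +
  \<beta> < 0. The logarithmic weights have d = \<bar>b + 1\<bar> / p > 0, so their cylinder may
  contain the axis. The number 2n is the homogeneous dimension of the dilations: against the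
  invariant measure r^(-2n) d\<xi>, the weight r^\<beta> becomes exp ((2n + \<beta>) s), so that p d
  = 2n + \<beta>. Orbits need not stay in \<Omega>; \<open>u\<close> vanishes with its derivative
  off its support, so the whole orbit can be used. All integrals take values in [0, \<infinity>], so
  the inequalities need no integrability argument.\<close>

lemma has_real_derivative_abs_powr:
  fixes p x :: real
  assumes "1 < p"
  shows "((\<lambda>x. \<bar>x\<bar> powr p) has_real_derivative p * \<bar>x\<bar> powr (p - 1) * sgn x) (at x)"
proof -
  consider "x > 0" | "x < 0" | "x = 0" by linarith
  then show ?thesis
  proof cases
    case 1
    have "((\<lambda>x. x powr p) has_real_derivative p * \<bar>x\<bar> powr (p - 1) * sgn x) (at x)"
      using 1 by (auto intro!: derivative_eq_intros)
    then show ?thesis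
      by (rule has_field_derivative_transform_within_open[where S = "{0<..}"]) (use 1 in auto)
  next
    case 2
    have "((\<lambda>x. (- x) powr p) has_real_derivative p * \<bar>x\<bar> powr (p - 1) * sgn x) (at x)"
      using 2 by (auto intro!: derivative_eq_intros)
    then show ?thesis
      by (rule has_field_derivative_transform_within_open[where S = "{..<0}"]) (use 2 in auto)
  next
    case 3
    \<comment> \<open>At the origin the difference quotient has absolute value
      \<open>\<bar>h\<bar> powr (p - 1)\<close>, which tends to 0 because p > 1.\<close>
    have "((\<lambda>h. \<bar>h\<bar> powr (p - 1)) \<longlongrightarrow> 0) (at (0::real))"
      using assms by (auto intro!: tendsto_eq_intros always_eventually)
    then have "((\<lambda>h. \<bar>h\<bar> powr p / h) \<longlongrightarrow> 0) (at (0::real))"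
      by (rule Lim_null_comparison[rotated]) (simp add: powr_diff)
    then show ?thesis
      using 3 by (simp add: DERIV_def)
  qed
qed

lemma Youngs_inequality_powr:
  fixes p x y :: real
  assumes "1 < p" "0 \<le> x" "0 \<le> y"
  shows "p * (x powr (p - 1) * y) \<le> (p - 1) * x powr p + y powr p"
proof -
  have "y * x powr (p - 1) \<le> y powr p / p + (x powr (p - 1)) powr (p / (p - 1)) / (p / (p - 1))"
    using assms by (intro Youngs_inequality) (auto simp: field_simps)
  also have "(x powr (p - 1)) powr (p / (p - 1)) = x powr p"
    using assms by (simp add: powr_powr)
  finally show ?thesis
    using assms by (simp add: field_simps)
qed

text \<open>The change of variable \<open>\<tau>\<close> reduces all weights to exponential ones: \<open>\<tau> = s\<close> gives
  the power weights in \<open>r = exp s\<close>, and \<open>\<tau> = - ln (ln R - s)\<close> the logarithmic ones.\<close>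

lemma hardy_interval:
  fixes f f' \<tau> \<tau>' :: "real \<Rightarrow> real" and a b p d :: real
  assumes p: "1 < p" and ab: "a \<le> b"
    and f: "\<And>s. s \<in> {a..b} \<Longrightarrow> (f has_real_derivative f' s) (at s)"
    and f': "continuous_on {a..b} f'"
    and \<tau>: "\<And>s. s \<in> {a..b} \<Longrightarrow> (\<tau> has_real_derivative \<tau>' s) (at s)"
    and \<tau>': "continuous_on {a..b} \<tau>'"
    and pos: "\<And>s. s \<in> {a..b} \<Longrightarrow> 0 < \<tau>' s"
    and bd: "0 \<le> d \<and> f b = 0 \<or> d \<le> 0 \<and> f a = 0"
  shows "ennreal (\<bar>d\<bar> powr p) *
      (\<integral>\<^sup>+s\<in>{a..b}. ennreal (\<bar>f s\<bar> powr p * (exp (p * d * \<tau> s) * \<tau>' s)) \<partial>lborel)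
    \<le> (\<integral>\<^sup>+s\<in>{a..b}. ennreal (\<bar>f' s\<bar> powr p * (exp (p * d * \<tau> s) * \<tau>' s powr (1 - p))) \<partial>lborel)"
proof -
  \<comment> \<open>\<open>G'\<close> consists of a cross term, which Young's inequality estimates,
    and of p d times the left-hand integrand \<open>P\<close>. Integrating \<open>G'\<close>
    therefore takes the place of an integration by parts.\<close>
  define G where "G s = \<bar>f s\<bar> powr p * exp (p * d * \<tau> s)" for s
  define G' where "G' s = p * \<bar>f s\<bar> powr (p - 1) * sgn (f s) * f' s * exp (p * d * \<tau> s)
      + \<bar>f s\<bar> powr p * (exp (p * d * \<tau> s) * (p * d * \<tau>' s))" for s
  define P where "P s = \<bar>f s\<bar> powr p * (exp (p * d * \<tau> s) * \<tau>' s)" for s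
  define S where "S s = \<bar>f' s\<bar> powr p * (exp (p * d * \<tau> s) * \<tau>' s powr (1 - p))" for s
  \<comment> \<open>The sign \<open>e\<close> selects the end at which \<open>f\<close> vanishes. It
    makes the boundary term \<open>e * (G b - G a)\<close> nonpositive and at the same time turns
    \<open>d\<close> into \<open>\<bar>d\<bar>\<close>.\<close>
  define e where "e = (if 0 \<le> d \<and> f b = 0 then 1 else - 1 :: real)"
  have ed: "e * d = \<bar>d\<bar>" "\<bar>e\<bar> = 1" using bd by (auto simp: e_def)
  have cf: "continuous_on {a..b} f" and ct: "continuous_on {a..b} \<tau>"
    using f \<tau> by (meson DERIV_continuous continuous_at_imp_continuous_on)+
  have "(G has_real_derivative G' s) (at s)" if "s \<in> {a..b}" for s
    unfolding G_def G'_def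
    by (rule derivative_eq_intros DERIV_chain2[OF has_real_derivative_abs_powr[OF p]]
        f[OF that] \<tau>[OF that] refl)+ (simp add: algebra_simps)
  then have "(G' has_integral (G b - G a)) {a..b}"
    using ab by (intro fundamental_theorem_of_calculus)
      (auto simp: has_real_derivative_iff_has_vector_derivative[symmetric]
        intro: has_field_derivative_at_within)
  then have iG: "((\<lambda>s. \<bar>d\<bar> powr (p - 1) * e * G' s) has_integral
      (\<bar>d\<bar> powr (p - 1) * e * (G b - G a))) {a..b}"
    by (rule has_integral_mult_right)
  have "continuous_on {a..b} P"
    unfolding P_def using p by (intro continuous_intros cf ct \<tau>' continuous_on_powr') auto
  then have iP: "(P has_integral integral {a..b} P) {a..b}"
    by (intro integrable_integral integrable_continuous_interval)
  have "continuous_on {a..b} S"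
    unfolding S_def using p pos by (intro continuous_intros f' ct \<tau>' continuous_on_powr') force+
  then have iS: "(S has_integral integral {a..b} S) {a..b}"
    by (intro integrable_integral integrable_continuous_interval)
  \<comment> \<open>Young's inequality with \<open>x = \<bar>d\<bar> \<bar>f\<bar>\<close> and \<open>y = \<bar>f'\<bar> / \<tau>'\<close> makes the estimate linear in both
    integrands, with the sharp constant.\<close>
  have ptw: "\<bar>d\<bar> powr p * P s \<le> \<bar>d\<bar> powr (p - 1) * e * G' s + S s" if s: "s \<in> {a..b}" for s
  proof -
    define t where "t = \<tau>' s"
    define E where "E = exp (p * d * \<tau> s)"
    have t: "t > 0" and E: "E > 0" using pos[OF s] by (auto simp: t_def E_def)
    have d1: "\<bar>d\<bar> powr p = \<bar>d\<bar> powr (p - 1) * \<bar>d\<bar>" using powr_mult_base[of "\<bar>d\<bar>" "p - 1"] by (simp add: mult.commute)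
    have "p * ((\<bar>d\<bar> * \<bar>f s\<bar>) powr (p - 1) * (\<bar>f' s\<bar> / t))
        \<le> (p - 1) * (\<bar>d\<bar> * \<bar>f s\<bar>) powr p + (\<bar>f' s\<bar> / t) powr p"
      using p t by (intro Youngs_inequality_powr) auto
    then have "p * ((\<bar>d\<bar> * \<bar>f s\<bar>) powr (p - 1) * (\<bar>f' s\<bar> / t)) * (t * E)
        \<le> ((p - 1) * (\<bar>d\<bar> * \<bar>f s\<bar>) powr p + (\<bar>f' s\<bar> / t) powr p) * (t * E)"
      using t E by (intro mult_right_mono) auto
    then have "p * ((\<bar>d\<bar> * \<bar>f s\<bar>) powr (p - 1) * (\<bar>f' s\<bar> / t)) * (t * E)
        \<le> (p - 1) * ((\<bar>d\<bar> * \<bar>f s\<bar>) powr p * (t * E)) + (\<bar>f' s\<bar> / t) powr p * (t * E)"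
      by (simp only: distrib_right mult.assoc)
    moreover have "p * ((\<bar>d\<bar> * \<bar>f s\<bar>) powr (p - 1) * (\<bar>f' s\<bar> / t)) * (t * E)
        = \<bar>d\<bar> powr (p - 1) * (p * \<bar>f s\<bar> powr (p - 1) * \<bar>f' s\<bar> * E)"
      using t by (simp add: powr_mult)
    moreover have "(\<bar>f' s\<bar> / t) powr p * (t * E) = S s"
      using t by (simp add: S_def E_def t_def powr_divide powr_diff)
    moreover have "(\<bar>d\<bar> * \<bar>f s\<bar>) powr p * (t * E) = \<bar>d\<bar> powr p * P s"
      by (simp add: powr_mult P_def t_def E_def)
    ultimately have 1: "\<bar>d\<bar> powr (p - 1) * (p * \<bar>f s\<bar> powr (p - 1) * \<bar>f' s\<bar> * E)
       \<le> (p - 1) * (\<bar>d\<bar> powr p * P s) + S s"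
      by (simp only:)
    have "\<bar>e * (p * \<bar>f s\<bar> powr (p - 1) * sgn (f s) * f' s * E)\<bar> \<le> p * \<bar>f s\<bar> powr (p - 1) * \<bar>f' s\<bar> * E"
      using p E ed(2) by (auto simp: abs_mult abs_sgn_eq)
    then have "- (p * \<bar>f s\<bar> powr (p - 1) * \<bar>f' s\<bar> * E) \<le> e * (p * \<bar>f s\<bar> powr (p - 1) * sgn (f s) * f' s * E)"
      by linarith
    then have "\<bar>d\<bar> powr (p - 1) * - (p * \<bar>f s\<bar> powr (p - 1) * \<bar>f' s\<bar> * E)
       \<le> \<bar>d\<bar> powr (p - 1) * (e * (p * \<bar>f s\<bar> powr (p - 1) * sgn (f s) * f' s * E))"
      by (intro mult_left_mono) auto
    moreover have "\<bar>d\<bar> powr (p - 1) * (e * (\<bar>f s\<bar> powr p * (E * (p * d * t)))) = p * (\<bar>d\<bar> powr p * P s)"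
    proof -
      have "\<bar>d\<bar> powr (p - 1) * (e * (\<bar>f s\<bar> powr p * (E * (p * d * t))))
          = p * ((\<bar>d\<bar> powr (p - 1) * (e * d)) * (\<bar>f s\<bar> powr p * (E * t)))"
        by simp
      also have "\<dots> = p * (\<bar>d\<bar> powr p * P s)"
        unfolding ed(1) d1 P_def E_def t_def by simp
      finally show ?thesis .
    qed
    moreover have "\<bar>d\<bar> powr (p - 1) * e * G' s = \<bar>d\<bar> powr (p - 1) * (e * (p * \<bar>f s\<bar> powr (p - 1) * sgn (f s) * f' s * E))
        + \<bar>d\<bar> powr (p - 1) * (e * (\<bar>f s\<bar> powr p * (E * (p * d * t))))"
      by (simp add: G'_def E_def t_def algebra_simps)
    moreover have "(p - 1) * (\<bar>d\<bar> powr p * P s) = p * (\<bar>d\<bar> powr p * P s) - \<bar>d\<bar> powr p * P s"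
      by (simp add: left_diff_distrib)
    ultimately show ?thesis using 1 by linarith
  qed
  have "((\<lambda>s. \<bar>d\<bar> powr p * P s) has_integral (\<bar>d\<bar> powr p * integral {a..b} P)) {a..b}"
    using iP by (rule has_integral_mult_right)
  from has_integral_le[OF this has_integral_add[OF iG iS]] ptw
  have "\<bar>d\<bar> powr p * integral {a..b} P \<le> \<bar>d\<bar> powr (p - 1) * (e * (G b - G a)) + integral {a..b} S"
    by (simp add: mult.assoc)
  moreover have "e * (G b - G a) \<le> 0"
    using bd by (auto simp: e_def G_def)
  ultimately have "\<bar>d\<bar> powr p * integral {a..b} P \<le> integral {a..b} S"
    by (smt (verit) mult_nonneg_nonpos powr_ge_zero)
  moreover have "(\<integral>\<^sup>+s\<in>{a..b}. ennreal (P s) \<partial>lborel) = ennreal (integral {a..b} P)"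
    using pos by (intro nn_integral_has_integral_lebesgue' iP) (auto simp: P_def less_imp_le)
  moreover have "(\<integral>\<^sup>+s\<in>{a..b}. ennreal (S s) \<partial>lborel) = ennreal (integral {a..b} S)"
    using pos by (intro nn_integral_has_integral_lebesgue' iS) (auto simp: S_def less_imp_le)
  ultimately show ?thesis
    by (simp add: P_def[symmetric] S_def[symmetric] ennreal_leI flip: ennreal_mult')
qed

section \<open>Dilation-invariant measure and polar coordinates\<close>

definition dil :: "real \<Rightarrow> 'n::finite pt \<Rightarrow> 'n pt" where
  "dil l \<xi> = (l *\<^sub>R xc \<xi>, l *\<^sub>R yc \<xi>, tc \<xi>)"

lemma dil_dil: "dil k (dil l \<xi>) = dil (k * l) \<xi>"
  by (simp add: dil_def xc_def yc_def tc_def)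

lemma dil_1 [simp]: "dil 1 \<xi> = \<xi>"
  by (simp add: dil_def xc_def yc_def tc_def)

lemma rr_dil: "rr (dil l \<xi>) = \<bar>l\<bar> * rr \<xi>"
  by (simp add: dil_def rr_def xc_def yc_def power_mult_distrib flip: distrib_left)
    (simp add: real_sqrt_mult)

lemma tc_dil [simp]: "tc (dil l \<xi>) = tc \<xi>"
  by (simp add: dil_def tc_def)

lemma rr_nonneg [simp]: "0 \<le> rr \<xi>"
  by (simp add: rr_def)

lemma continuous_on_xc [continuous_intros]: "continuous_on S f \<Longrightarrow> continuous_on S (\<lambda>x. xc (f x))"
  unfolding xc_def by (intro continuous_intros)
lemma continuous_on_yc [continuous_intros]: "continuous_on S f \<Longrightarrow> continuous_on S (\<lambda>x. yc (f x))"
  unfolding yc_def by (intro continuous_intros)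
lemma continuous_on_tc [continuous_intros]: "continuous_on S f \<Longrightarrow> continuous_on S (\<lambda>x. tc (f x))"
  unfolding tc_def by (intro continuous_intros)
lemma continuous_on_rr [continuous_intros]: "continuous_on S f \<Longrightarrow> continuous_on S (\<lambda>x. rr (f x))"
  unfolding rr_def by (intro continuous_intros)

lemma rr_borel [measurable]: "(rr :: 'n::finite pt \<Rightarrow> real) \<in> borel_measurable borel"
  by (intro borel_measurable_continuous_onI continuous_intros)

lemma tc_borel [measurable]: "(tc :: 'n::finite pt \<Rightarrow> real) \<in> borel_measurable borel"
  by (intro borel_measurable_continuous_onI continuous_intros)

lemma bounded_cylinder: "bounded {\<xi> :: 'n::finite pt. rr \<xi> \<le> a \<and> \<bar>tc \<xi>\<bar> \<le> T}"
proof (rule boundedI)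
  fix \<xi> :: "'n pt" assume k: "\<xi> \<in> {\<xi>. rr \<xi> \<le> a \<and> \<bar>tc \<xi>\<bar> \<le> T}"
  have "norm (xc \<xi>) \<le> rr \<xi>" "norm (yc \<xi>) \<le> rr \<xi>"
    by (auto simp: rr_def intro!: real_le_rsqrt)
  then have "norm (fst \<xi>) + (norm (fst (snd \<xi>)) + norm (snd (snd \<xi>))) \<le> a + (a + T)"
    using k by (auto simp: xc_def yc_def tc_def)
  moreover have "norm \<xi> \<le> norm (fst \<xi>) + norm (snd \<xi>)" "norm (snd \<xi>) \<le> norm (fst (snd \<xi>)) + norm (snd (snd \<xi>))"
    by (metis norm_Pair_le prod.collapse)+
  ultimately show "norm \<xi> \<le> a + (a + T)" by linarith
qed

lemma dil_borel [measurable]: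
  assumes "g \<in> borel_measurable M" "f \<in> M \<rightarrow>\<^sub>M borel"
  shows "(\<lambda>x. dil (g x) (f x)) \<in> M \<rightarrow>\<^sub>M (borel :: 'n::finite pt measure)"
proof -
  have "(\<lambda>z. dil (fst z) (snd z)) \<in> borel \<rightarrow>\<^sub>M (borel :: 'n pt measure)"
    unfolding dil_def by (intro borel_measurable_continuous_onI continuous_intros)
  then have "(\<lambda>z. dil (fst z) (snd z)) \<in> borel \<Otimes>\<^sub>M borel \<rightarrow>\<^sub>M (borel :: 'n pt measure)"
    by (simp add: borel_prod)
  from measurable_compose[OF measurable_Pair[OF assms] this] show ?thesis by simp
qed

lemma prod_Basis_prod:
  fixes f :: "'a::euclidean_space \<times> 'b::euclidean_space \<Rightarrow> 'c::comm_monoid_mult"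
  shows "prod f Basis = (\<Prod>i\<in>Basis. f (i, 0)) * (\<Prod>i\<in>Basis. f (0, i))"
proof -
  have "inj_on (\<lambda>u. (u::'a, 0::'b)) Basis" and "inj_on (\<lambda>u. (0::'a, u::'b)) Basis"
    by (auto intro!: inj_onI)
  then show ?thesis
    unfolding Basis_prod_def
    by (subst prod.union_disjoint) (auto simp: prod.reindex)
qed

lemma nn_integral_dil:
  fixes F :: "'n::finite pt \<Rightarrow> ennreal"
  assumes F [measurable]: "F \<in> borel_measurable borel" and l: "0 < l"
  shows "(\<integral>\<^sup>+\<xi>. F \<xi> \<partial>lborel) = ennreal (l ^ (2 * CARD('n))) * (\<integral>\<^sup>+\<xi>. F (dil l \<xi>) \<partial>lborel)"
proof -
  \<comment> \<open>Diagonal entries of \<open>dil l\<close> in the standard basis. Only the basis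
    vector of the t-axis has a nonzero last component, so the entry l occurs 2n times and the
    Jacobian is l^(2n).\<close>
  define c :: "'n pt \<Rightarrow> real" where "c j = (if snd (snd j) = 0 then l else 1)" for j
  define T where "T x = 0 + (\<Sum>j\<in>Basis. (c j * (x \<bullet> j)) *\<^sub>R j)" for x
  have T: "T = dil l"
  proof (rule ext, rule euclidean_eqI)
    fix x b :: "'n pt" assume b: "b \<in> Basis"
    have "T x \<bullet> b = c b * (x \<bullet> b)"
      using b by (simp add: T_def)
    also have "\<dots> = dil l x \<bullet> b"
      using b by (auto simp: c_def dil_def xc_def yc_def tc_def Basis_prod_def inner_prod_def)
    finally show "T x \<bullet> b = dil l x \<bullet> b" .
  qed
  have Pi: "(\<Prod>j\<in>Basis. \<bar>c j\<bar>) = l ^ (2 * CARD('n))"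
    using l by (simp add: prod_Basis_prod c_def power_add mult_2)
  have "(\<integral>\<^sup>+\<xi>. F \<xi> \<partial>lborel) = (\<integral>\<^sup>+\<xi>. F \<xi> \<partial>density (distr lborel borel T) (\<lambda>_. (\<Prod>j\<in>Basis. \<bar>c j\<bar>)))"
    unfolding T_def using l by (subst lborel_affine_euclidean[symmetric]) (auto simp: c_def)
  also have "\<dots> = ennreal (l ^ (2 * CARD('n))) * (\<integral>\<^sup>+\<xi>. F (dil l \<xi>) \<partial>lborel)"
    unfolding T Pi by (simp add: nn_integral_density nn_integral_distr nn_integral_cmult)
  finally show ?thesis .
qed

text \<open>The density \<open>r\<close> to the power \<open>- 2n\<close> makes the measure invariant under \<^const>\<open>dil\<close>
  (and, as \<open>0 powr a = 0\<close>, null on the axis \<open>r = 0\<close>).\<close>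

definition hmeas :: "'n::finite pt measure" where
  "hmeas = density lborel (\<lambda>\<xi>. ennreal (rr \<xi> powr (- (2 * real CARD('n)))))"

lemma sets_hmeas [measurable_cong, simp]: "sets hmeas = sets borel"
  by (simp add: hmeas_def)

lemma space_hmeas [simp]: "space hmeas = UNIV"
  by (simp add: hmeas_def)

lemma sigma_finite_hmeas: "sigma_finite_measure (hmeas :: 'n::finite pt measure)"
  unfolding hmeas_def by (subst sigma_finite_measure.sigma_finite_iff_density_finite[OF sigma_finite_lborel]) auto

lemma nn_integral_hmeas:
  fixes F :: "'n::finite pt \<Rightarrow> ennreal"
  assumes "F \<in> borel_measurable borel"
  shows "(\<integral>\<^sup>+\<xi>. F \<xi> \<partial>hmeas) = (\<integral>\<^sup>+\<xi>. ennreal (rr \<xi> powr (- (2 * real CARD('n)))) * F \<xi> \<partial>lborel)"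
  unfolding hmeas_def using assms by (subst nn_integral_density) auto

lemma AE_hmeas_rr_pos: "AE \<xi> in (hmeas :: 'n::finite pt measure). 0 < rr \<xi>"
  unfolding hmeas_def by (subst AE_density) (auto intro!: AE_I2 simp: less_le)

text \<open>The Jacobian l^(2n) cancels the factor l^(-2n) that the density acquires under the
  dilation.\<close>

lemma nn_integral_hmeas_dil:
  fixes F :: "'n::finite pt \<Rightarrow> ennreal"
  assumes F [measurable]: "F \<in> borel_measurable borel" and l: "0 < l"
  shows "(\<integral>\<^sup>+\<xi>. F (dil l \<xi>) \<partial>hmeas) = (\<integral>\<^sup>+\<xi>. F \<xi> \<partial>hmeas)"
proof -
  let ?w = "\<lambda>x. x powr (- (2 * real CARD('n)))"
  have w: "ennreal (l ^ (2 * CARD('n))) * ennreal (?w (rr (dil l \<xi>))) = ennreal (?w (rr \<xi>))" for \<xi> :: "'n pt"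
    using l by (simp add: rr_dil powr_mult powr_minus powr_realpow[symmetric] ennreal_mult[symmetric])
  have "(\<integral>\<^sup>+\<xi>. F \<xi> \<partial>hmeas) = (\<integral>\<^sup>+\<xi>. ennreal (?w (rr \<xi>)) * F \<xi> \<partial>lborel)"
    by (rule nn_integral_hmeas) fact
  also have "\<dots> = ennreal (l ^ (2 * CARD('n))) * (\<integral>\<^sup>+\<xi>. ennreal (?w (rr (dil l \<xi>))) * F (dil l \<xi>) \<partial>lborel)"
    using l by (subst nn_integral_dil) auto
  also have "\<dots> = (\<integral>\<^sup>+\<xi>. ennreal (?w (rr \<xi>)) * F (dil l \<xi>) \<partial>lborel)"
    by (subst nn_integral_cmult[symmetric]) (auto simp: w mult.assoc[symmetric])
  also have "\<dots> = (\<integral>\<^sup>+\<xi>. F (dil l \<xi>) \<partial>hmeas)"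
    by (rule nn_integral_hmeas[symmetric]) simp
  finally show ?thesis by simp
qed

text \<open>The orbit of \<xi> parametrised by s = ln r, independently of the point of the orbit
  taken as \<xi>. In this parameter the radial derivative is d/ds. For \<xi> on the axis, division
  by zero makes the curve constant.\<close>

definition ray :: "'n::finite pt \<Rightarrow> real \<Rightarrow> 'n pt" where
  "ray \<xi> s = dil (exp s / rr \<xi>) \<xi>"

lemma rr_ray: "rr \<xi> \<noteq> 0 \<Longrightarrow> rr (ray \<xi> s) = exp s"
  by (simp add: ray_def rr_dil abs_divide)

lemma tc_ray [simp]: "tc (ray \<xi> s) = tc \<xi>"
  by (simp add: ray_def)

definition shell :: "'n::finite pt set" where
  "shell = {\<xi>. 1 < rr \<xi> \<and> rr \<xi> \<le> exp 1}"

lemma shell_borel [measurable]: "(shell :: 'n::finite pt set) \<in> sets borel"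
  unfolding shell_def by measurable

text \<open>Polar coordinates without a surface measure: instead of the unit cylinder \<open>r = 1\<close> one averages
  over the base points in a shell that every orbit of \<^const>\<open>dil\<close> meets for a logarithmic time of length 1.\<close>

theorem nn_integral_polar:
  fixes F :: "'n::finite pt \<Rightarrow> ennreal"
  assumes F [measurable]: "F \<in> borel_measurable borel"
  shows "(\<integral>\<^sup>+\<xi>. F \<xi> \<partial>hmeas) = (\<integral>\<^sup>+\<xi>\<in>shell. (\<integral>\<^sup>+s. F (ray \<xi> s) \<partial>lborel) \<partial>hmeas)"
proof -
  interpret h: sigma_finite_measure "hmeas :: 'n pt measure" by (rule sigma_finite_hmeas)
  interpret P: pair_sigma_finite "hmeas :: 'n pt measure" "lborel :: real measure" ..
  \<comment> \<open>Normalising the base point to r = 1 only shifts s by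
    \<open>ln (rr \<xi>)\<close>, which Lebesgue measure does not see.\<close>
  have translate: "(\<integral>\<^sup>+s. F (ray \<xi> s) \<partial>lborel) = (\<integral>\<^sup>+s. F (dil (exp s) \<xi>) \<partial>lborel)" if "\<xi> \<in> shell" for \<xi>
  proof -
    have r: "rr \<xi> > 0" using that by (auto simp: shell_def)
    have "(\<integral>\<^sup>+s. F (ray \<xi> s) \<partial>lborel) = (\<integral>\<^sup>+s. F (ray \<xi> (ln (rr \<xi>) + 1 * s)) \<partial>lborel)"
      unfolding ray_def by (subst nn_integral_real_affine[where c = 1 and t = "ln (rr \<xi>)"]) auto
    then show ?thesis using r by (simp add: ray_def exp_add)
  qed
  \<comment> \<open>The orbit stays in the shell exactly for
    \<open>ln (rr \<eta>) - 1 \<le> s < ln (rr \<eta>)\<close>. Since this time is 1, averaging over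
    the shell needs no normalising factor.\<close>
  have one: "(\<integral>\<^sup>+s. indicator shell (dil (exp (- s)) \<eta>) \<partial>lborel) = 1" if r: "rr \<eta> > 0" for \<eta> :: "'n pt"
  proof -
    have "indicator shell (dil (exp (- s)) \<eta>) = (indicator {ln (rr \<eta>) - 1..<ln (rr \<eta>)} s :: ennreal)" for s
    proof -
      have "dil (exp (- s)) \<eta> \<in> shell \<longleftrightarrow> s \<in> {ln (rr \<eta>) - 1..<ln (rr \<eta>)}"
      proof -
        have "rr (dil (exp (- s)) \<eta>) = exp (ln (rr \<eta>) - s)"
          using r by (simp add: rr_dil exp_diff exp_minus field_simps)
        then have "dil (exp (- s)) \<eta> \<in> shell \<longleftrightarrow> exp 0 < exp (ln (rr \<eta>) - s) \<and> exp (ln (rr \<eta>) - s) \<le> exp 1"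
          by (simp add: shell_def)
        then show ?thesis unfolding exp_less_cancel_iff exp_le_cancel_iff by auto
      qed
      then show ?thesis by (simp add: indicator_def)
    qed
    then show ?thesis by simp
  qed
  have "(\<integral>\<^sup>+\<xi>\<in>shell. (\<integral>\<^sup>+s. F (ray \<xi> s) \<partial>lborel) \<partial>hmeas)
      = (\<integral>\<^sup>+\<xi>. (\<integral>\<^sup>+s. F (dil (exp s) \<xi>) * indicator shell \<xi> \<partial>lborel) \<partial>hmeas)"
    using translate by (intro nn_integral_cong) (auto simp: indicator_def)
  also have "\<dots> = (\<integral>\<^sup>+s. (\<integral>\<^sup>+\<xi>. F (dil (exp s) \<xi>) * indicator shell \<xi> \<partial>hmeas) \<partial>lborel)"
    by (rule P.Fubini'[symmetric]) measurable
  \<comment> \<open>For fixed s, invariance of \<open>hmeas\<close> moves the dilation from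
    \<open>F\<close> to the indicator. After a second exchange of integrals only the time computed
    in \<open>one\<close> remains.\<close>
  also have "\<dots> = (\<integral>\<^sup>+s. (\<integral>\<^sup>+\<eta>. F \<eta> * indicator shell (dil (exp (- s)) \<eta>) \<partial>hmeas) \<partial>lborel)"
  proof (rule nn_integral_cong)
    fix s :: real
    show "(\<integral>\<^sup>+\<xi>. F (dil (exp s) \<xi>) * indicator shell \<xi> \<partial>hmeas)
        = (\<integral>\<^sup>+\<eta>. F \<eta> * indicator shell (dil (exp (- s)) \<eta>) \<partial>hmeas)"
      using nn_integral_hmeas_dil[of "\<lambda>\<eta>. F \<eta> * indicator shell (dil (exp (- s)) \<eta>)" "exp s"]
      by (simp add: dil_dil exp_minus)
  qed
  also have "\<dots> = (\<integral>\<^sup>+\<eta>. (\<integral>\<^sup>+s. F \<eta> * indicator shell (dil (exp (- s)) \<eta>) \<partial>lborel) \<partial>hmeas)"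
    by (rule P.Fubini') measurable
  also have "\<dots> = (\<integral>\<^sup>+\<eta>. F \<eta> * (\<integral>\<^sup>+s. indicator shell (dil (exp (- s)) \<eta>) \<partial>lborel) \<partial>hmeas)"
    by (intro nn_integral_cong nn_integral_cmult) measurable
  also have "\<dots> = (\<integral>\<^sup>+\<eta>. F \<eta> \<partial>hmeas)"
    using AE_hmeas_rr_pos by (intro nn_integral_cong_AE) (auto simp: one)
  finally show ?thesis by simp
qed

section \<open>The weighted Hardy inequality\<close>

text \<open>\<Omega> and the complement of the support are open and cover the whole space, and on
  the latter \<open>u\<close> is zero. Hence the regularity given on \<Omega> holds globally, and
  later arguments may follow an orbit out of \<Omega>.\<close>

lemma C1_0_derivative:
  fixes u :: "'n::finite pt \<Rightarrow> real"
  assumes u: "u \<in> C1_0 \<Omega>" and \<Omega>: "open \<Omega>"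
  shows C1_0_has_derivative: "(u has_derivative frechet_derivative u (at \<xi>)) (at \<xi>)"
    and C1_0_derivative_continuous: "continuous_on UNIV (\<lambda>\<xi>. frechet_derivative u (at \<xi>) v)"
    and C1_0_derivative_eq_0: "\<xi> \<notin> closure {\<xi>. u \<xi> \<noteq> 0} \<Longrightarrow> frechet_derivative u (at \<xi>) = (\<lambda>_. 0)"
proof -
  define S where "S = closure {\<xi>. u \<xi> \<noteq> 0}"
  have "\<exists>D. (\<forall>\<xi>\<in>\<Omega>. (u has_derivative D \<xi>) (at \<xi>)) \<and> (\<forall>v. continuous_on \<Omega> (\<lambda>\<xi>. D \<xi> v))"
    using u unfolding C1_0_def mem_Collect_eq by (rule conjunct1)
  then obtain D where D: "\<And>\<xi>. \<xi> \<in> \<Omega> \<Longrightarrow> (u has_derivative D \<xi>) (at \<xi>)"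
    and cD: "\<And>v. continuous_on \<Omega> (\<lambda>\<xi>. D \<xi> v)"
    by blast
  have S\<Omega>: "S \<subseteq> \<Omega>"
    using u unfolding C1_0_def S_def mem_Collect_eq by (elim conjE)
  have S0: "u \<xi> = 0" if "\<xi> \<notin> S" for \<xi>
    using that closure_subset[of "{\<xi>. u \<xi> \<noteq> 0}"] by (auto simp: S_def)
  have off: "(u has_derivative (\<lambda>_. 0)) (at \<xi>)" if "\<xi> \<notin> S" for \<xi>
  proof (rule has_derivative_transform_within_open)
    show "((\<lambda>_. 0) has_derivative (\<lambda>_. 0)) (at \<xi>)" by simp
    show "open (- S)" by (simp add: S_def open_Compl)
  qed (use that S0 in auto)
  have f1: "frechet_derivative u (at \<xi>) = D \<xi>" if "\<xi> \<in> \<Omega>" for \<xi>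
    using D[OF that] by (rule frechet_derivative_at[symmetric])
  have f2: "frechet_derivative u (at \<xi>) = (\<lambda>_. 0)" if "\<xi> \<notin> S" for \<xi>
    using off[OF that] by (rule frechet_derivative_at[symmetric])
  show "(u has_derivative frechet_derivative u (at \<xi>)) (at \<xi>)"
    using D[of \<xi>] off[of \<xi>] f1[of \<xi>] f2[of \<xi>] S\<Omega> by (cases "\<xi> \<in> S") auto
  show "\<xi> \<notin> closure {\<xi>. u \<xi> \<noteq> 0} \<Longrightarrow> frechet_derivative u (at \<xi>) = (\<lambda>_. 0)"
    using f2 by (simp add: S_def)
  have "continuous_on (\<Omega> \<union> - S) (\<lambda>\<xi>. frechet_derivative u (at \<xi>) v)"
  proof (rule continuous_on_open_Un)
    show "continuous_on \<Omega> (\<lambda>\<xi>. frechet_derivative u (at \<xi>) v)"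
      using cD[of v] f1 by (simp cong: continuous_on_cong)
    show "continuous_on (- S) (\<lambda>\<xi>. frechet_derivative u (at \<xi>) v)"
      by (rule continuous_on_eq[OF continuous_on_const[of _ 0]]) (simp add: f2)
  qed (auto simp: \<Omega> S_def)
  moreover have "\<Omega> \<union> - S = UNIV" using S\<Omega> by auto
  ultimately show "continuous_on UNIV (\<lambda>\<xi>. frechet_derivative u (at \<xi>) v)" by simp
qed

lemma C1_0_continuous:
  assumes "u \<in> C1_0 \<Omega>" "open \<Omega>"
  shows "continuous_on UNIV u"
  using C1_0_has_derivative[OF assms] has_derivative_continuous
  by (blast intro: continuous_at_imp_continuous_on)

text \<open>The derivative along the dilations \<^term>\<open>dil l\<close>; it only involves the horizontal
  fields, since the \<open>t\<close>-components of \<open>x\<^sub>i X\<^sub>i\<close> and \<open>y\<^sub>i Y\<^sub>i\<close> cancel.\<close>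

definition radial :: "('n::finite pt \<Rightarrow> real) \<Rightarrow> 'n pt \<Rightarrow> real" where
  "radial u \<xi> = frechet_derivative u (at \<xi>) (xc \<xi>, yc \<xi>, 0)"

lemma radial_eq_sum:
  assumes "(u has_derivative frechet_derivative u (at \<xi>)) (at \<xi>)"
  shows "radial u \<xi> = (\<Sum>i\<in>UNIV. xc \<xi> $ i * dx u i \<xi> + yc \<xi> $ i * dy u i \<xi>)"
proof -
  interpret D: linear "frechet_derivative u (at \<xi>)"
    using assms by (rule has_derivative_linear)
  have "(xc \<xi>, yc \<xi>, 0) = (\<Sum>i\<in>UNIV. (xc \<xi> $ i) *\<^sub>R (axis i 1, 0, 0) + (yc \<xi> $ i) *\<^sub>R (0, axis i 1, 0 :: real))"
    by (auto simp: prod_eq_iff fst_sum snd_sum vec_eq_iff axis_def if_distrib cong: if_cong)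
  then show ?thesis
    unfolding radial_def dx_def dy_def
    by (simp add: D.sum D.add D.scale del: scaleR_Pair)
qed

lemma abs_radial_le:
  assumes "(u has_derivative frechet_derivative u (at \<xi>)) (at \<xi>)"
  shows "\<bar>radial u \<xi>\<bar> \<le> rr \<xi> * gradL_norm \<gamma> u \<xi>"
proof -
  \<comment> \<open>The 2n horizontal components are indexed by one finite type, so that a single
    application of Cauchy-Schwarz covers the x- and y-directions together.\<close>
  define a where "a = (\<lambda>(b::bool, i). if b then xc \<xi> $ i else yc \<xi> $ i)"
  define g where "g = (\<lambda>(b::bool, i). if b then XX \<gamma> u i \<xi> else YY \<gamma> u i \<xi>)"
  have sum_bool: "(\<Sum>z\<in>UNIV. h z) = (\<Sum>i\<in>UNIV. h (True, i) + h (False, i))"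
    for h :: "bool \<times> 'a \<Rightarrow> real"
  proof -
    have "(\<Sum>z\<in>UNIV. h z) = (\<Sum>b\<in>UNIV. \<Sum>i\<in>UNIV. h (b, i))"
      by (simp add: sum.cartesian_product flip: UNIV_Times_UNIV)
    then show ?thesis by (simp add: UNIV_bool sum.distrib add.commute)
  qed
  have 1: "radial u \<xi> = (\<Sum>z\<in>UNIV. a z * g z)"
    unfolding sum_bool a_def g_def XX_def YY_def radial_eq_sum[OF assms]
    by (simp add: algebra_simps)
  have 2: "rr \<xi> = sqrt (\<Sum>z\<in>UNIV. (a z)\<^sup>2)"
    unfolding rr_def sum_bool by (simp add: a_def norm_vec_def L2_set_def sum.distrib sum_nonneg)
  have 3: "gradL_norm \<gamma> u \<xi> = sqrt (\<Sum>z\<in>UNIV. (g z)\<^sup>2)"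
    unfolding gradL_norm_def sum_bool by (simp add: g_def)
  have "\<bar>radial u \<xi>\<bar> = sqrt ((\<Sum>z\<in>UNIV. a z * g z)\<^sup>2)"
    by (simp add: 1)
  also have "\<dots> \<le> sqrt ((\<Sum>z\<in>UNIV. (a z)\<^sup>2) * (\<Sum>z\<in>UNIV. (g z)\<^sup>2))"
    by (intro real_sqrt_le_mono Cauchy_Schwarz_ineq_sum)
  finally show ?thesis by (simp add: 2 3 real_sqrt_mult)
qed

lemma radial_continuous:
  assumes "u \<in> C1_0 \<Omega>" "open \<Omega>"
  shows "continuous_on UNIV (radial u)"
proof -
  have "radial u = (\<lambda>\<xi>. \<Sum>i\<in>UNIV. xc \<xi> $ i * dx u i \<xi> + yc \<xi> $ i * dy u i \<xi>)"
    using radial_eq_sum C1_0_has_derivative[OF assms] by blast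
  then show ?thesis
    unfolding dx_def dy_def by (simp add: continuous_intros C1_0_derivative_continuous[OF assms])
qed

lemma gradL_norm_borel:
  assumes "u \<in> C1_0 \<Omega>" "open \<Omega>"
  shows "gradL_norm \<gamma> u \<in> borel_measurable borel"
proof -
  have [measurable]: "(\<lambda>\<xi>. frechet_derivative u (at \<xi>) v) \<in> borel_measurable borel" for v
    using C1_0_derivative_continuous[OF assms] by (rule borel_measurable_continuous_onI)
  have [measurable]: "(\<lambda>\<xi>::'a pt. xc \<xi> $ i) \<in> borel_measurable borel"
    "(\<lambda>\<xi>::'a pt. yc \<xi> $ i) \<in> borel_measurable borel" for i
    by (intro borel_measurable_continuous_onI continuous_intros)+
  show ?thesis
    unfolding gradL_norm_def XX_def YY_def dx_def dy_def dt_def by measurable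
qed

section \<open>Passage from the orbits to the space\<close>

lemma has_derivative_ray:
  assumes "\<And>\<xi>. (u has_derivative frechet_derivative u (at \<xi>)) (at \<xi>)"
  shows "((\<lambda>s. u (ray \<xi> s)) has_real_derivative radial u (ray \<xi> s)) (at s)"
proof -
  have e: "((\<lambda>s. exp s / rr \<xi>) has_derivative (\<lambda>h. h * (exp s / rr \<xi>))) (at s)"
    unfolding divide_inverse by (auto intro!: derivative_eq_intros)
  have "(ray \<xi> has_derivative (\<lambda>h. h *\<^sub>R (xc (ray \<xi> s), yc (ray \<xi> s), 0))) (at s)"
    unfolding ray_def[abs_def] dil_def
    by (rule has_derivative_eq_rhs[OF has_derivative_Pair[OF has_derivative_scaleR_left[OF e]
          has_derivative_Pair[OF has_derivative_scaleR_left[OF e] has_derivative_const]]])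
      (auto simp: xc_def yc_def)
  from diff_chain_at[OF this assms]
  have "((\<lambda>s. u (ray \<xi> s)) has_derivative
      (\<lambda>h. frechet_derivative u (at (ray \<xi> s)) (h *\<^sub>R (xc (ray \<xi> s), yc (ray \<xi> s), 0)))) (at s)"
    by (simp add: o_def)
  also have "(\<lambda>h. frechet_derivative u (at (ray \<xi> s)) (h *\<^sub>R (xc (ray \<xi> s), yc (ray \<xi> s), 0)))
      = (*) (radial u (ray \<xi> s))"
    unfolding linear_cmul[OF has_derivative_linear[OF assms]] by (auto simp: radial_def)
  finally show ?thesis by (simp add: has_field_derivative_def)
qed

lemma continuous_on_ray: "continuous_on UNIV (ray \<xi>)"
  unfolding ray_def[abs_def] dil_def divide_inverse by (intro continuous_intros)

lemma ray_borel [measurable]: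
  assumes [measurable]: "g \<in> borel_measurable M" "f \<in> M \<rightarrow>\<^sub>M borel"
  shows "(\<lambda>x. ray (f x) (g x)) \<in> M \<rightarrow>\<^sub>M (borel :: 'n::finite pt measure)"
  unfolding ray_def by measurable

text \<open>Monotone convergence as the left end moves to minus infinity, that is, towards the axis.
  The threshold \<open>N\<close> is there because for d < 0 the bound is available only once the
  left end lies below the support.\<close>

lemma nn_integral_le_exhaustion:
  fixes h :: "real \<Rightarrow> ennreal"
  assumes [measurable]: "h \<in> borel_measurable borel"
    and le: "\<And>k. N \<le> k \<Longrightarrow> (\<integral>\<^sup>+s\<in>{- real k..}. h s \<partial>lborel) \<le> X"
  shows "(\<integral>\<^sup>+s. h s \<partial>lborel) \<le> X"
proof -
  have sup: "(SUP k. h s * indicator {- real (N + k)..} s) = h s" for s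
  proof (rule antisym)
    obtain k where "- s \<le> real k" using real_arch_simple by blast
    then have "h s \<le> h s * indicator {- real (N + k)..} s" by (auto simp: indicator_def)
    then show "h s \<le> (SUP k. h s * indicator {- real (N + k)..} s)"
      by (rule SUP_upper2[rotated]) simp
  qed (auto intro!: SUP_least simp: indicator_def)
  have "incseq (\<lambda>k s. h s * indicator {- real (N + k)..} s)"
    by (auto simp: incseq_def le_fun_def indicator_def)
  then have "(\<integral>\<^sup>+s. (SUP k. h s * indicator {- real (N + k)..} s) \<partial>lborel)
      = (SUP k. \<integral>\<^sup>+s\<in>{- real (N + k)..}. h s \<partial>lborel)"
    by (intro nn_integral_monotone_convergence_SUP) auto
  also have "\<dots> \<le> X" by (intro SUP_least le) simp
  finally show ?thesis unfolding sup .
qed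

text \<open>The inequality of \<open>hardy_interval\<close> holds on every orbit with the same
  constant, so it survives integration over the orbits. The weights are prescribed only below
  \<open>L\<close>, since the logarithmic ones have their meaning only for r < R; the hypothesis
  \<open>outer\<close> confines the support to that region.\<close>

theorem hardy_weighted:
  fixes u :: "'n::finite pt \<Rightarrow> real" and \<tau> \<tau>' V Z :: "real \<Rightarrow> real" and p d L \<gamma> :: real
  assumes p: "1 < p" and u: "u \<in> C1_0 \<Omega>" and \<Omega>: "open \<Omega>"
    and \<tau>: "\<And>s. s < L \<Longrightarrow> (\<tau> has_real_derivative \<tau>' s) (at s)"
    and \<tau>': "continuous_on {..<L} \<tau>'" and pos: "\<And>s. s < L \<Longrightarrow> 0 < \<tau>' s"
    and [measurable]: "V \<in> borel_measurable borel" "Z \<in> borel_measurable borel"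
    and V: "\<And>s. s < L \<Longrightarrow> V s = exp (p * d * \<tau> s) * \<tau>' s"
    and Z: "\<And>s. s < L \<Longrightarrow> Z s = exp (p * d * \<tau> s) * \<tau>' s powr (1 - p)"
    and outer: "\<And>\<xi>. \<xi> \<in> closure {\<xi>. u \<xi> \<noteq> 0} \<Longrightarrow> rr \<xi> < exp L"
    and inner: "d < 0 \<Longrightarrow> \<Omega> \<subseteq> {\<xi>. rr \<xi> \<noteq> 0}"
  shows "ennreal (\<bar>d\<bar> powr p) * (\<integral>\<^sup>+\<xi>\<in>\<Omega>. ennreal (\<bar>u \<xi>\<bar> powr p * V (ln (rr \<xi>))) \<partial>hmeas)
    \<le> (\<integral>\<^sup>+\<xi>\<in>\<Omega>. ennreal ((rr \<xi> * gradL_norm \<gamma> u \<xi>) powr p * Z (ln (rr \<xi>))) \<partial>hmeas)"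
proof -
  define S where "S = closure {\<xi>. u \<xi> \<noteq> 0}"
  have cS: "compact S" and S\<Omega>: "S \<subseteq> \<Omega>" using u by (auto simp: C1_0_def S_def)
  have u0: "u \<xi> = 0" if "\<xi> \<notin> S" for \<xi>
    using that closure_subset[of "{\<xi>. u \<xi> \<noteq> 0}"] by (auto simp: S_def)
  have E0: "radial u \<xi> = 0" if "\<xi> \<notin> S" for \<xi>
    using that C1_0_derivative_eq_0[OF u \<Omega>, of \<xi>] by (simp add: radial_def S_def)
  note du = C1_0_has_derivative[OF u \<Omega>]
  have [measurable]: "\<Omega> \<in> sets borel" using \<Omega> by simp
  have [measurable]: "u \<in> borel_measurable borel" "radial u \<in> borel_measurable borel"
    "gradL_norm \<gamma> u \<in> borel_measurable borel"
    using C1_0_continuous[OF u \<Omega>] radial_continuous[OF u \<Omega>] gradL_norm_borel[OF u \<Omega>]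
    by (auto intro: borel_measurable_continuous_onI)
  have cr: "continuous_on S rr" by (intro continuous_on_rr continuous_on_id)
  \<comment> \<open>Compactness leaves a gap between the support and r = exp L. All intervals can
    therefore end at \<open>K\<close>, where \<open>u\<close> vanishes and \<open>\<tau>\<close> is
    still regular.\<close>
  obtain K where K: "K < L" and SK: "\<And>\<xi>. \<xi> \<in> S \<Longrightarrow> rr \<xi> < exp K"
  proof (cases "S = {}")
    case False
    then obtain \<xi>0 where x0: "\<xi>0 \<in> S" "\<And>\<xi>. \<xi> \<in> S \<Longrightarrow> rr \<xi> \<le> rr \<xi>0"
      using continuous_attains_sup[OF cS False cr] by blast
    then have "rr \<xi>0 < exp L" using outer by (simp add: S_def)
    then obtain z where z: "rr \<xi>0 < z" "z < exp L" using dense by blast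
    then have "z > 0" using rr_nonneg[of \<xi>0] by linarith
    then have "ln z < L" using z by (metis exp_gt_zero ln_exp ln_less_cancel_iff)
    moreover have "rr \<xi> < exp (ln z)" if "\<xi> \<in> S" for \<xi>
      using x0(2)[OF that] z \<open>z > 0\<close> by simp
    ultimately show ?thesis by (rule that)
  qed (auto intro: that[of "L - 1"])
  \<comment> \<open>Only for d < 0 must \<open>u\<close> vanish at the left end. In that case
    \<open>inner\<close> keeps the compact support off the axis, so r has a positive minimum on
    it.\<close>
  obtain N where N: "- real N \<le> K" and SN: "\<And>\<xi>. d < 0 \<Longrightarrow> \<xi> \<in> S \<Longrightarrow> exp (- real N) < rr \<xi>"
  proof (cases "S = {} \<or> d \<ge> 0")
    case False
    then obtain \<xi>0 where x0: "\<xi>0 \<in> S" "\<And>\<xi>. \<xi> \<in> S \<Longrightarrow> rr \<xi>0 \<le> rr \<xi>"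
      using continuous_attains_inf[OF cS _ cr] by blast
    have r0: "rr \<xi>0 > 0" using x0 S\<Omega> inner False rr_nonneg[of \<xi>0] by (force simp: less_le)
    obtain N where "max (- K) (1 - ln (rr \<xi>0)) \<le> real N" using real_arch_simple by blast
    then have "- real N \<le> K" "- real N < ln (rr \<xi>0)" by auto
    moreover from this have "exp (- real N) < rr \<xi>0"
      using r0 by (metis exp_less_cancel_iff exp_ln)
    ultimately show ?thesis
      using x0(2) by (intro that[of N]) (blast intro: order.strict_trans2)+
  next
    case True
    obtain N where "- K \<le> real N" using real_arch_simple by blast
    then show ?thesis using True by (intro that[of N]) auto
  qed
  have one_dim: "ennreal (\<bar>d\<bar> powr p) * (\<integral>\<^sup>+s. ennreal (\<bar>u (ray \<xi> s)\<bar> powr p * V s) \<partial>lborel)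
      \<le> (\<integral>\<^sup>+s. ennreal (\<bar>radial u (ray \<xi> s)\<bar> powr p * Z s) \<partial>lborel)" if "\<xi> \<in> shell" for \<xi>
  proof -
    have r: "rr \<xi> \<noteq> 0" using that by (auto simp: shell_def)
    have out: "ray \<xi> s \<notin> S" if "s \<ge> K" for s
    proof
      assume "ray \<xi> s \<in> S"
      from SK[OF this] that show False using r by (simp add: rr_ray)
    qed
    have ins: "ray \<xi> s \<notin> S" if "s \<le> - real N" "d < 0" for s
    proof
      assume "ray \<xi> s \<in> S"
      from SN[OF _ this] that show False using r by (simp add: rr_ray)
    qed
    have "(\<integral>\<^sup>+s. ennreal (\<bar>d\<bar> powr p) * ennreal (\<bar>u (ray \<xi> s)\<bar> powr p * V s) \<partial>lborel)
      \<le> (\<integral>\<^sup>+s. ennreal (\<bar>radial u (ray \<xi> s)\<bar> powr p * Z s) \<partial>lborel)"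
    proof (rule nn_integral_le_exhaustion[where N = N])
      fix k assume k: "N \<le> k"
      have lt: "s < L" if "s \<in> {- real k..K}" for s using that K by auto
      have "(\<integral>\<^sup>+s\<in>{- real k..}. ennreal (\<bar>d\<bar> powr p) * ennreal (\<bar>u (ray \<xi> s)\<bar> powr p * V s) \<partial>lborel)
          = (\<integral>\<^sup>+s. ennreal (\<bar>d\<bar> powr p) * (ennreal (\<bar>u (ray \<xi> s)\<bar> powr p * (exp (p * d * \<tau> s) * \<tau>' s)) * indicator {- real k..K} s) \<partial>lborel)"
        using lt out u0 V p by (intro nn_integral_cong) (auto simp: indicator_def not_le)
      also have "\<dots> \<le> ennreal (\<bar>d\<bar> powr p) * (\<integral>\<^sup>+s\<in>{- real k..K}. ennreal (\<bar>u (ray \<xi> s)\<bar> powr p * (exp (p * d * \<tau> s) * \<tau>' s)) \<partial>lborel)"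
      proof -
        \<comment> \<open>Measurability of the weight expressed through \<open>\<tau>\<close> is
          inherited from \<open>V\<close>, with which it agrees on the interval.\<close>
        have "(\<lambda>s. ennreal (\<bar>u (ray \<xi> s)\<bar> powr p * V s) * indicator {- real k..K} s) \<in> borel_measurable lborel"
          by measurable
        then have "(\<lambda>s. ennreal (\<bar>u (ray \<xi> s)\<bar> powr p * (exp (p * d * \<tau> s) * \<tau>' s)) * indicator {- real k..K} s) \<in> borel_measurable lborel"
          by (rule measurable_cong[THEN iffD1, rotated]) (use lt V in \<open>auto simp: indicator_def\<close>)
        then show ?thesis by (subst nn_integral_cmult) auto
      qed
      also have "\<dots> \<le> (\<integral>\<^sup>+s\<in>{- real k..K}. ennreal (\<bar>radial u (ray \<xi> s)\<bar> powr p * (exp (p * d * \<tau> s) * \<tau>' s powr (1 - p))) \<partial>lborel)"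
      proof (rule hardy_interval[OF p])
        show "- real k \<le> K" using k N by simp
        show "((\<lambda>s. u (ray \<xi> s)) has_real_derivative radial u (ray \<xi> s)) (at s)" for s
          by (rule has_derivative_ray[OF du])
        show "continuous_on {- real k..K} (\<lambda>s. radial u (ray \<xi> s))"
          by (rule continuous_on_compose2[OF radial_continuous[OF u \<Omega>]])
            (auto intro: continuous_on_subset[OF continuous_on_ray])
        show "continuous_on {- real k..K} \<tau>'" using lt by (auto intro: continuous_on_subset[OF \<tau>'])
        show "0 \<le> d \<and> u (ray \<xi> K) = 0 \<or> d \<le> 0 \<and> u (ray \<xi> (- real k)) = 0"
          using u0 out[of K] ins[of "- real k"] k by (cases "d < 0") auto
      qed (use lt \<tau> pos in auto)
      also have "\<dots> \<le> (\<integral>\<^sup>+s. ennreal (\<bar>radial u (ray \<xi> s)\<bar> powr p * Z s) \<partial>lborel)"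
        using lt Z by (intro nn_integral_mono) (auto simp: indicator_def)
      finally show "(\<integral>\<^sup>+s\<in>{- real k..}. ennreal (\<bar>d\<bar> powr p) * ennreal (\<bar>u (ray \<xi> s)\<bar> powr p * V s) \<partial>lborel)
          \<le> (\<integral>\<^sup>+s. ennreal (\<bar>radial u (ray \<xi> s)\<bar> powr p * Z s) \<partial>lborel)" .
    qed measurable
    then show ?thesis by (subst (asm) nn_integral_cmult) auto
  qed
  have lnray: "ln (rr (ray \<xi> s)) = s" if "\<xi> \<in> shell" for \<xi> :: "'n pt" and s
    using that by (subst rr_ray) (auto simp: shell_def)
  have "ennreal (\<bar>d\<bar> powr p) * (\<integral>\<^sup>+\<xi>\<in>\<Omega>. ennreal (\<bar>u \<xi>\<bar> powr p * V (ln (rr \<xi>))) \<partial>hmeas)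
      \<le> ennreal (\<bar>d\<bar> powr p) * (\<integral>\<^sup>+\<xi>. ennreal (\<bar>u \<xi>\<bar> powr p * V (ln (rr \<xi>))) \<partial>hmeas)"
    by (intro mult_left_mono nn_integral_mono) (auto simp: indicator_def)
  also have "\<dots> = (\<integral>\<^sup>+\<xi>. ennreal (\<bar>d\<bar> powr p) * ennreal (\<bar>u \<xi>\<bar> powr p * V (ln (rr \<xi>))) \<partial>hmeas)"
    by (rule nn_integral_cmult[symmetric]) measurable
  also have "\<dots> = (\<integral>\<^sup>+\<xi>\<in>shell. (\<integral>\<^sup>+s. ennreal (\<bar>d\<bar> powr p) * ennreal (\<bar>u (ray \<xi> s)\<bar> powr p * V (ln (rr (ray \<xi> s)))) \<partial>lborel) \<partial>hmeas)"
    by (rule nn_integral_polar) measurable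
  also have "\<dots> \<le> (\<integral>\<^sup>+\<xi>\<in>shell. (\<integral>\<^sup>+s. ennreal (\<bar>radial u (ray \<xi> s)\<bar> powr p * Z (ln (rr (ray \<xi> s)))) \<partial>lborel) \<partial>hmeas)"
    using one_dim by (intro nn_integral_mono) (auto simp: indicator_def lnray nn_integral_cmult)
  also have "\<dots> = (\<integral>\<^sup>+\<xi>. ennreal (\<bar>radial u \<xi>\<bar> powr p * Z (ln (rr \<xi>))) \<partial>hmeas)"
    by (rule nn_integral_polar[symmetric]) measurable
  also have "\<dots> \<le> (\<integral>\<^sup>+\<xi>\<in>\<Omega>. ennreal ((rr \<xi> * gradL_norm \<gamma> u \<xi>) powr p * Z (ln (rr \<xi>))) \<partial>hmeas)"
  proof (rule nn_integral_mono_AE)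
    \<comment> \<open>\<open>Z\<close> is known to be nonnegative only below \<open>L\<close>, so
      the gradient bound is multiplied by it on the support alone. Elsewhere the left side is
      zero.\<close>
    have le: "ennreal (\<bar>radial u \<xi>\<bar> powr p * Z (ln (rr \<xi>)))
        \<le> ennreal ((rr \<xi> * gradL_norm \<gamma> u \<xi>) powr p * Z (ln (rr \<xi>))) * indicator \<Omega> \<xi>" if "rr \<xi> > 0" for \<xi>
    proof (cases "\<xi> \<in> S")
      case True
      then have "ln (rr \<xi>) < L"
        using outer[of \<xi>] that by (metis S_def exp_gt_zero ln_exp ln_less_cancel_iff)
      then have "0 \<le> Z (ln (rr \<xi>))" using Z by simp
      then show ?thesis
        using True S\<Omega> p abs_radial_le[OF du, of \<xi> \<gamma>]
        by (auto simp: indicator_def intro!: ennreal_leI mult_right_mono powr_mono2)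
    qed (use E0 p in simp)
    show "AE \<xi> in hmeas. ennreal (\<bar>radial u \<xi>\<bar> powr p * Z (ln (rr \<xi>)))
        \<le> ennreal ((rr \<xi> * gradL_norm \<gamma> u \<xi>) powr p * Z (ln (rr \<xi>))) * indicator \<Omega> \<xi>"
      using AE_hmeas_rr_pos le by (auto elim: eventually_mono)
  qed
  finally show ?thesis .
qed

section \<open>Test functions\<close>

text \<open>Membership in \<open>C1_0\<close> asks for one continuous derivative, so a piecewise
  polynomial cut-off suffices: the outer square smooths the corner of the maximum.\<close>

definition bump :: "real \<Rightarrow> real" where
  "bump x = (max 0 (1 - x\<^sup>2))\<^sup>2"

definition bump' :: "real \<Rightarrow> real" where
  "bump' x = - 4 * x * max 0 (1 - x\<^sup>2)"

lemma has_real_derivative_max_0_square: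
  "((\<lambda>y. (max 0 y)\<^sup>2) has_real_derivative 2 * max 0 y) (at (y::real))"
proof -
  consider "y > 0" | "y < 0" | "y = 0" by linarith
  then show ?thesis
  proof cases
    case 1
    have "((\<lambda>y. y\<^sup>2) has_real_derivative 2 * max 0 y) (at y)"
      using 1 by (auto intro!: derivative_eq_intros)
    then show ?thesis
      by (rule has_field_derivative_transform_within_open[where S = "{0<..}"]) (use 1 in auto)
  next
    case 2
    have "((\<lambda>y. 0) has_real_derivative 2 * max 0 y) (at y)"
      using 2 by auto
    then show ?thesis
      by (rule has_field_derivative_transform_within_open[where S = "{..<0}"]) (use 2 in auto)
  next
    case 3
    have "((\<lambda>h. (max 0 h)\<^sup>2 / h) \<longlongrightarrow> 0) (at (0::real))"
      by (rule Lim_null_comparison[where g = abs])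
        (auto intro!: always_eventually tendsto_rabs_zero simp: max_def power2_eq_square)
    then show ?thesis using 3 by (simp add: DERIV_def)
  qed
qed

lemma has_real_derivative_bump: "(bump has_real_derivative bump' x) (at x)"
proof -
  have "((\<lambda>x. 1 - x\<^sup>2) has_real_derivative - 2 * x) (at x)"
    by (auto intro!: derivative_eq_intros)
  from DERIV_chain2[OF has_real_derivative_max_0_square this] show ?thesis
    unfolding bump_def[abs_def] bump'_def by (simp add: mult_ac)
qed

lemma continuous_on_bump: "continuous_on S bump" and continuous_on_bump': "continuous_on S bump'"
  unfolding bump_def[abs_def] bump'_def[abs_def] by (intro continuous_intros)+

lemma bump_eq_0: "1 \<le> \<bar>x\<bar> \<Longrightarrow> bump x = 0" and bump'_eq_0: "1 \<le> \<bar>x\<bar> \<Longrightarrow> bump' x = 0"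
  using abs_le_square_iff[of 1 x] by (auto simp: bump_def bump'_def)

lemma bump_nonneg: "0 \<le> bump x" and bump_le_1: "bump x \<le> 1"
  by (auto simp: bump_def intro: power_le_one)

lemma bump_ge_half:
  assumes "\<bar>x\<bar> \<le> 1 / 2" shows "1 / 2 \<le> bump x"
proof -
  have "x\<^sup>2 \<le> (1 / 2)\<^sup>2" using assms by (subst abs_le_square_iff[symmetric]) auto
  then have "(3 / 4)\<^sup>2 \<le> (max 0 (1 - x\<^sup>2))\<^sup>2" by (intro power_mono) (auto simp: power2_eq_square)
  then show ?thesis by (simp add: bump_def power2_eq_square)
qed

lemma abs_bump'_le: "\<bar>bump' x\<bar> \<le> 4"
proof (cases "\<bar>x\<bar> \<le> 1")
  case True
  have "\<bar>x\<bar> * max 0 (1 - x\<^sup>2) \<le> 1 * 1" using True by (intro mult_mono) auto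
  then show ?thesis by (simp add: bump'_def abs_mult)
qed (use bump'_eq_0[of x] in auto)

text \<open>The value on the axis is set by hand because \<open>ln 0\<close> is only a default
  value. If \<open>f\<close> vanishes towards minus infinity, zero is also the value near the axis,
  and the product is regular there.\<close>

definition separated :: "(real \<Rightarrow> real) \<Rightarrow> (real \<Rightarrow> real) \<Rightarrow> 'n::finite pt \<Rightarrow> real" where
  "separated f g \<xi> = (if rr \<xi> = 0 then 0 else f (ln (rr \<xi>)) * g (tc \<xi>))"

context
  fixes f f' g g' :: "real \<Rightarrow> real" and a b T :: real
  assumes f: "\<And>s. (f has_real_derivative f' s) (at s)" and f': "continuous_on UNIV f'"
    and g: "\<And>t. (g has_real_derivative g' t) (at t)" and g': "continuous_on UNIV g'"
    and f0: "\<And>s. s \<notin> {a..b} \<Longrightarrow> f s = 0" and g0: "\<And>t. T < \<bar>t\<bar> \<Longrightarrow> g t = 0"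
begin

lemma has_derivative_separated:
  fixes \<xi> :: "'n::finite pt"
  assumes r: "0 < rr \<xi>"
  shows "(separated f g has_derivative
    (\<lambda>v. f' (ln (rr \<xi>)) * g (tc \<xi>) / (rr \<xi>)\<^sup>2 * (xc \<xi> \<bullet> xc v + yc \<xi> \<bullet> yc v) + f (ln (rr \<xi>)) * g' (tc \<xi>) * tc v)) (at \<xi>)"
proof -
  \<comment> \<open>With q = r^2 one has ln r = ln q / 2, which avoids differentiating a square
    root.\<close>
  define q :: "'n pt \<Rightarrow> real" where "q \<xi> = xc \<xi> \<bullet> xc \<xi> + yc \<xi> \<bullet> yc \<xi>" for \<xi>
  have q: "rr \<eta> = sqrt (q \<eta>)" for \<eta> by (simp add: rr_def q_def power2_norm_eq_inner)
  have q0: "q \<eta> \<ge> 0" for \<eta> by (simp add: q_def)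
  have qr: "q \<xi> = (rr \<xi>)\<^sup>2" and qpos: "q \<xi> > 0" using r q0[of \<xi>] by (auto simp: q)
  have lnr: "ln (rr \<eta>) = ln (q \<eta>) / 2" if "0 < rr \<eta>" for \<eta>
    using that by (simp add: q ln_sqrt)
  have dq: "(q has_derivative (\<lambda>v. 2 * (xc \<xi> \<bullet> xc v + yc \<xi> \<bullet> yc v))) (at \<xi>)"
    unfolding q_def[abs_def] xc_def yc_def
    by (auto intro!: derivative_eq_intros simp: inner_commute)
  have "((\<lambda>\<eta>. ln (q \<eta>) / 2) has_derivative (\<lambda>v. (xc \<xi> \<bullet> xc v + yc \<xi> \<bullet> yc v) / (rr \<xi>)\<^sup>2)) (at \<xi>)"
    by (rule derivative_eq_intros dq qpos refl)+ (use r in \<open>auto simp: qr field_simps\<close>)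
  from has_derivative_compose[OF this f[unfolded has_field_derivative_def]]
  have d1: "((\<lambda>\<eta>. f (ln (q \<eta>) / 2)) has_derivative
      (\<lambda>v. f' (ln (rr \<xi>)) * ((xc \<xi> \<bullet> xc v + yc \<xi> \<bullet> yc v) / (rr \<xi>)\<^sup>2))) (at \<xi>)"
    by (simp add: lnr[OF r])
  have "(tc has_derivative tc) (at \<xi>)"
    unfolding tc_def[abs_def] by (auto intro!: derivative_eq_intros)
  from has_derivative_compose[OF this g[unfolded has_field_derivative_def]]
  have d2: "((\<lambda>\<eta>. g (tc \<eta>)) has_derivative (\<lambda>v. g' (tc \<xi>) * tc v)) (at \<xi>)" .
  have "((\<lambda>\<eta>. f (ln (q \<eta>) / 2) * g (tc \<eta>)) has_derivative
    (\<lambda>v. f' (ln (rr \<xi>)) * g (tc \<xi>) / (rr \<xi>)\<^sup>2 * (xc \<xi> \<bullet> xc v + yc \<xi> \<bullet> yc v) + f (ln (rr \<xi>)) * g' (tc \<xi>) * tc v)) (at \<xi>)"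
    by (rule has_derivative_eq_rhs[OF has_derivative_mult[OF d1 d2]]) (auto simp: lnr[OF r] algebra_simps)
  then show ?thesis
  proof (rule has_derivative_transform_within_open)
    show "open {\<eta> :: 'n pt. 0 < rr \<eta>}"
      by (intro open_Collect_less continuous_intros)
  qed (use r in \<open>simp_all add: separated_def lnr\<close>)
qed

text \<open>The formula for the derivative is continuous where r > 0, while function and derivative
  vanish where r < exp a. These two open sets cover the space, and the support lies in a compact
  cylindrical shell.\<close>

lemma separated_C1_0:
  fixes \<Omega> :: "'n::finite pt set"
  assumes sub: "{\<xi>. exp a \<le> rr \<xi> \<and> rr \<xi> \<le> exp b \<and> \<bar>tc \<xi>\<bar> \<le> T} \<subseteq> \<Omega>"
  shows "separated f g \<in> C1_0 \<Omega>"
proof -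
  let ?K = "{\<xi> :: 'n pt. exp a \<le> rr \<xi> \<and> rr \<xi> \<le> exp b \<and> \<bar>tc \<xi>\<bar> \<le> T}"
  define D :: "'n pt \<Rightarrow> 'n pt \<Rightarrow> real" where "D \<xi> v = (if rr \<xi> = 0 then 0 else
    f' (ln (rr \<xi>)) * g (tc \<xi>) / (rr \<xi>)\<^sup>2 * (xc \<xi> \<bullet> xc v + yc \<xi> \<bullet> yc v) + f (ln (rr \<xi>)) * g' (tc \<xi>) * tc v)" for \<xi> v
  have f'0: "f' s = 0" if "s < a" for s
  proof -
    have "((\<lambda>_. 0) has_real_derivative f' s) (at s)"
      by (rule has_field_derivative_transform_within_open[OF f, where S = "{..<a}"]) (use that f0 in auto)
    then show ?thesis using DERIV_unique DERIV_const by blast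
  qed
  have lna: "ln (rr \<xi>) < a" if "0 < rr \<xi>" "rr \<xi> < exp a" for \<xi> :: "'n pt"
    using that by (metis exp_gt_zero ln_exp ln_less_cancel_iff)
  have near0: "separated f g \<xi> = 0" "D \<xi> v = 0" if "rr \<xi> < exp a" for \<xi> v
    using lna[OF _ that] f0 f'0 rr_nonneg[of \<xi>] by (auto simp: separated_def D_def less_le)
  have oa: "open {\<xi> :: 'n pt. rr \<xi> < exp a}" and op: "open {\<xi> :: 'n pt. 0 < rr \<xi>}"
    by (intro open_Collect_less continuous_intros)+
  have cover: "{\<xi> :: 'n pt. 0 < rr \<xi>} \<union> {\<xi>. rr \<xi> < exp a} = UNIV"
    using rr_nonneg by (auto simp: less_le)
  have der: "(separated f g has_derivative D \<xi>) (at \<xi>)" for \<xi>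
  proof (cases "rr \<xi> = 0")
    case True
    have "(separated f g has_derivative (\<lambda>_. 0)) (at \<xi>)"
    proof (rule has_derivative_transform_within_open)
      show "((\<lambda>_. 0) has_derivative (\<lambda>_. 0)) (at \<xi>)" by simp
    qed (use oa True near0 in auto)
    then show ?thesis using True by (simp add: D_def[abs_def])
  next
    case False
    then show ?thesis using has_derivative_separated[of \<xi>] rr_nonneg[of \<xi>] by (simp add: D_def[abs_def] less_le)
  qed
  have cont: "continuous_on UNIV (\<lambda>\<xi>. D \<xi> v)" for v
    unfolding cover[symmetric]
  proof (rule continuous_on_open_Un[OF op oa])
    have cf: "continuous_on UNIV f" and cg: "continuous_on UNIV g"
      using f g by (meson DERIV_continuous continuous_at_imp_continuous_on)+
    have "continuous_on {\<xi> :: 'n pt. 0 < rr \<xi>} (\<lambda>\<xi>. f' (ln (rr \<xi>)) * g (tc \<xi>) / (rr \<xi>)\<^sup>2 * (xc \<xi> \<bullet> xc v + yc \<xi> \<bullet> yc v)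
        + f (ln (rr \<xi>)) * g' (tc \<xi>) * tc v)"
      by (intro continuous_intros continuous_on_compose2[OF f'] continuous_on_compose2[OF cf]
          continuous_on_compose2[OF cg] continuous_on_compose2[OF g']) auto
    then show "continuous_on {\<xi> :: 'n pt. 0 < rr \<xi>} (\<lambda>\<xi>. D \<xi> v)"
      by (rule continuous_on_eq) (auto simp: D_def)
    show "continuous_on {\<xi> :: 'n pt. rr \<xi> < exp a} (\<lambda>\<xi>. D \<xi> v)"
      by (rule continuous_on_eq[OF continuous_on_const[of _ 0]]) (simp add: near0)
  qed
  have clK: "closed ?K"
    by (intro closed_Collect_conj closed_Collect_le continuous_intros)
  have "bounded ?K"
    by (rule bounded_subset[OF bounded_cylinder[of "exp b" T]]) auto
  with clK have cK: "compact ?K" by (simp add: compact_eq_bounded_closed)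
  have "{\<xi>. separated f g \<xi> \<noteq> 0} \<subseteq> ?K"
  proof
    fix \<xi> :: "'n pt" assume "\<xi> \<in> {\<xi>. separated f g \<xi> \<noteq> 0}"
    then have r: "rr \<xi> \<noteq> 0" and "f (ln (rr \<xi>)) \<noteq> 0" "g (tc \<xi>) \<noteq> 0"
      by (auto simp: separated_def split: if_splits)
    then have 1: "ln (rr \<xi>) \<in> {a..b}" "\<bar>tc \<xi>\<bar> \<le> T" using f0 g0 by (meson not_le)+
    have "rr \<xi> = exp (ln (rr \<xi>))" using r rr_nonneg[of \<xi>] by (subst exp_ln) (auto simp: less_le)
    moreover have "exp a \<le> exp (ln (rr \<xi>))" "exp (ln (rr \<xi>)) \<le> exp b"
      using 1(1) by (simp_all only: exp_le_cancel_iff atLeastAtMost_iff)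
    ultimately show "\<xi> \<in> ?K" using 1(2) by simp
  qed
  then have clos: "closure {\<xi> :: 'n pt. separated f g \<xi> \<noteq> 0} \<subseteq> ?K"
    using clK by (rule closure_minimal)
  have "\<exists>D. (\<forall>\<xi>\<in>\<Omega>. (separated f g has_derivative D \<xi>) (at \<xi>)) \<and> (\<forall>v. continuous_on \<Omega> (\<lambda>\<xi>. D \<xi> v))"
    by (intro exI[of _ D] conjI ballI allI der continuous_on_subset[OF cont] subset_UNIV)
  moreover have "compact (closure {\<xi> :: 'n pt. separated f g \<xi> \<noteq> 0})"
    using compact_Int_closed[OF cK closed_closure, of "{\<xi>. separated f g \<xi> \<noteq> 0}"] clos
    by (simp only: Int_absorb1)
  ultimately show ?thesis
    unfolding C1_0_def mem_Collect_eq using clos sub by (intro conjI order_trans[OF clos sub])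
qed

text \<open>The horizontal gradient is a multiple of (x, y) coming from \<open>f'\<close> plus a
  multiple of (y, - x) coming from \<open>g'\<close>. These vectors are orthogonal and both have
  length r, so the squares add up exactly. After multiplication by r the second part carries
  r^(2\<gamma>), which makes it small near the axis.\<close>

lemma gradL_norm_separated_le:
  fixes \<xi> :: "'n::finite pt"
  assumes r: "0 < rr \<xi>" and \<gamma>: "0 \<le> \<gamma>"
  shows "rr \<xi> * gradL_norm \<gamma> (separated f g) \<xi>
    \<le> \<bar>f' (ln (rr \<xi>))\<bar> * \<bar>g (tc \<xi>)\<bar> + 2 * \<gamma> * rr \<xi> powr (2 * \<gamma>) * \<bar>f (ln (rr \<xi>))\<bar> * \<bar>g' (tc \<xi>)\<bar>"
proof -
  define A where "A = f' (ln (rr \<xi>)) * g (tc \<xi>)"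
  define B where "B = f (ln (rr \<xi>)) * g' (tc \<xi>)"
  define R where "R = rr \<xi>"
  define w where "w = 2 * \<gamma> * R powr (2 * \<gamma> - 2) * B"
  have fd: "frechet_derivative (separated f g) (at \<xi>) = (\<lambda>v. A / R\<^sup>2 * (xc \<xi> \<bullet> xc v + yc \<xi> \<bullet> yc v) + B * tc v)"
    using has_derivative_separated[OF r] unfolding A_def B_def R_def
    by (rule frechet_derivative_at[symmetric])
  have X: "XX \<gamma> (separated f g) i \<xi> = (A / R\<^sup>2) * xc \<xi> $ i + w * yc \<xi> $ i" for i
    unfolding XX_def dx_def dt_def fd by (simp add: xc_def yc_def tc_def inner_axis w_def R_def)
  have Y: "YY \<gamma> (separated f g) i \<xi> = (A / R\<^sup>2) * yc \<xi> $ i - w * xc \<xi> $ i" for i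
    unfolding YY_def dy_def dt_def fd by (simp add: xc_def yc_def tc_def inner_axis w_def R_def)
  have R2: "R\<^sup>2 = (\<Sum>i\<in>UNIV. (xc \<xi> $ i)\<^sup>2 + (yc \<xi> $ i)\<^sup>2)"
    by (simp add: R_def rr_def norm_vec_def L2_set_def sum.distrib sum_nonneg)
  have "(\<Sum>i\<in>UNIV. (XX \<gamma> (separated f g) i \<xi>)\<^sup>2 + (YY \<gamma> (separated f g) i \<xi>)\<^sup>2)
      = (\<Sum>i\<in>UNIV. ((A / R\<^sup>2)\<^sup>2 + w\<^sup>2) * ((xc \<xi> $ i)\<^sup>2 + (yc \<xi> $ i)\<^sup>2))"
    unfolding X Y by (intro sum.cong refl) algebra
  also have "\<dots> = ((A / R\<^sup>2)\<^sup>2 + w\<^sup>2) * R\<^sup>2"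
    by (simp add: R2 sum_distrib_left)
  finally have "rr \<xi> * gradL_norm \<gamma> (separated f g) \<xi> = sqrt ((A / R\<^sup>2)\<^sup>2 + w\<^sup>2) * R\<^sup>2"
    using r unfolding gradL_norm_def by (simp add: real_sqrt_mult R_def power2_eq_square)
  also have "\<dots> \<le> (\<bar>A / R\<^sup>2\<bar> + \<bar>w\<bar>) * R\<^sup>2"
    by (intro mult_right_mono sqrt_sum_squares_le_sum_abs) auto
  also have "\<dots> = \<bar>A\<bar> + 2 * \<gamma> * (R powr (2 * \<gamma> - 2) * R\<^sup>2) * \<bar>B\<bar>"
    using r \<gamma> by (simp add: w_def R_def abs_mult distrib_right)
  also have "R powr (2 * \<gamma> - 2) * R\<^sup>2 = R powr (2 * \<gamma>)"
    using r by (simp add: R_def powr_diff)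
  finally show ?thesis by (simp add: A_def B_def R_def abs_mult mult_ac)
qed

end

text \<open>The factor of the main term x can be kept close to 1 at the price of a large factor for
  the error y. Either y \<le> e x or x < y / e, and one summand alone controls the sum.\<close>

lemma add_powr_le:
  fixes x y e p :: real
  assumes "0 \<le> x" "0 \<le> y" "0 < e" "0 \<le> p"
  shows "(x + y) powr p \<le> (1 + e) powr p * x powr p + (1 + 1 / e) powr p * y powr p"
proof (cases "y \<le> e * x")
  case True
  then have "(x + y) powr p \<le> ((1 + e) * x) powr p"
    using assms by (intro powr_mono2) (auto simp: algebra_simps)
  then show ?thesis by (simp add: powr_mult add_increasing2)
next
  case False
  then have "(x + y) powr p \<le> ((1 + 1 / e) * y) powr p"
    using assms by (intro powr_mono2) (auto simp: field_simps)
  then show ?thesis by (simp add: powr_mult add_increasing)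
qed

text \<open>As t is constant along orbits, the factor depending on t leaves the inner integral. The
  unknown shell integral is a constant which can be cancelled when both sides of the Hardy
  inequality are compared.\<close>

lemma nn_integral_polar_product:
  fixes h g :: "real \<Rightarrow> ennreal"
  assumes [measurable]: "h \<in> borel_measurable borel" "g \<in> borel_measurable borel"
  shows "(\<integral>\<^sup>+\<xi>. h (ln (rr \<xi>)) * g (tc \<xi>) \<partial>(hmeas :: 'n::finite pt measure))
    = (\<integral>\<^sup>+s. h s \<partial>lborel) * (\<integral>\<^sup>+\<xi>\<in>shell. g (tc \<xi>) \<partial>(hmeas :: 'n pt measure))"
proof -
  have lnray: "ln (rr (ray \<xi> s)) = s" if "\<xi> \<in> shell" for \<xi> :: "'n pt" and s
    using that by (subst rr_ray) (auto simp: shell_def)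
  have "(\<integral>\<^sup>+\<xi>. h (ln (rr \<xi>)) * g (tc \<xi>) \<partial>(hmeas :: 'n pt measure))
    = (\<integral>\<^sup>+\<xi>\<in>shell. (\<integral>\<^sup>+s. h (ln (rr (ray \<xi> s))) * g (tc (ray \<xi> s)) \<partial>lborel) \<partial>(hmeas :: 'n pt measure))"
    by (rule nn_integral_polar) measurable
  also have "\<dots> = (\<integral>\<^sup>+\<xi>\<in>shell. (\<integral>\<^sup>+s. h s \<partial>lborel) * g (tc \<xi>) \<partial>(hmeas :: 'n pt measure))"
    by (intro nn_integral_cong) (auto simp: lnray indicator_def nn_integral_multc)
  also have "\<dots> = (\<integral>\<^sup>+\<xi>. (\<integral>\<^sup>+s. h s \<partial>lborel) * (g (tc \<xi>) * indicator shell \<xi>) \<partial>(hmeas :: 'n pt measure))"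
    by (simp add: mult.assoc)
  also have "\<dots> = (\<integral>\<^sup>+s. h s \<partial>lborel) * (\<integral>\<^sup>+\<xi>\<in>shell. g (tc \<xi>) \<partial>(hmeas :: 'n pt measure))"
    by (rule nn_integral_cmult) measurable
  finally show ?thesis .
qed

lemma shell_slab_integral_finite:
  fixes g :: "real \<Rightarrow> real"
  assumes [measurable]: "g \<in> borel_measurable borel"
    and g0: "\<And>t. T < \<bar>t\<bar> \<Longrightarrow> g t = 0" and gB: "\<And>t. g t \<le> B"
  shows "(\<integral>\<^sup>+\<xi>\<in>shell. ennreal (g (tc \<xi>)) \<partial>(hmeas :: 'n::finite pt measure)) < \<infinity>"
proof -
  define K where "K = {\<xi> :: 'n pt. 1 < rr \<xi> \<and> rr \<xi> \<le> exp 1 \<and> \<bar>tc \<xi>\<bar> \<le> T}"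
  have [measurable]: "K \<in> sets borel" unfolding K_def by measurable
  have "bounded K"
    by (rule bounded_subset[OF bounded_cylinder[of "exp 1" T]]) (auto simp: K_def)
  then have fin: "emeasure lborel K < \<infinity>" by (rule emeasure_bounded_finite)
  have "(\<integral>\<^sup>+\<xi>\<in>shell. ennreal (g (tc \<xi>)) \<partial>(hmeas :: 'n pt measure)) \<le> (\<integral>\<^sup>+\<xi>. ennreal B * indicator K \<xi> \<partial>hmeas)"
    using g0 gB by (intro nn_integral_mono) (auto simp: shell_def K_def indicator_def not_le intro!: ennreal_leI)
  also have "\<dots> = (\<integral>\<^sup>+\<xi>. ennreal (rr \<xi> powr (- (2 * real CARD('n)))) * (ennreal B * indicator K \<xi>) \<partial>lborel)"
    by (rule nn_integral_hmeas) measurable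
  also have "\<dots> \<le> (\<integral>\<^sup>+\<xi>. ennreal B * indicator K \<xi> \<partial>lborel)"
  proof (rule nn_integral_mono)
    fix \<xi> :: "'n pt"
    \<comment> \<open>The density of \<open>hmeas\<close> is at most 1 on the shell because r > 1
      there.\<close>
    have "ennreal (rr \<xi> powr (- (2 * real CARD('n)))) \<le> 1" if "\<xi> \<in> K"
      using powr_mono2'[of "- (2 * real CARD('n))" 1 "rr \<xi>"] that by (simp add: K_def)
    then show "ennreal (rr \<xi> powr (- (2 * real CARD('n)))) * (ennreal B * indicator K \<xi>) \<le> ennreal B * indicator K \<xi>"
      using mult_right_mono[of "ennreal (rr \<xi> powr (- (2 * real CARD('n))))" 1 "ennreal B * indicator K \<xi>"]
      by (auto simp: indicator_def)
  qed
  also have "\<dots> = ennreal B * emeasure lborel K"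
    by (simp add: nn_integral_cmult)
  also have "\<dots> < \<infinity>" using fin by (simp add: ennreal_mult_less_top)
  finally show ?thesis .
qed

lemma shell_slab_integral_pos:
  fixes g :: "real \<Rightarrow> real"
  assumes [measurable]: "g \<in> borel_measurable borel"
    and T: "0 < T" and g: "\<And>t. \<bar>t\<bar> < T \<Longrightarrow> 0 < g t"
  shows "0 < (\<integral>\<^sup>+\<xi>\<in>shell. ennreal (g (tc \<xi>)) \<partial>(hmeas :: 'n::finite pt measure))"
proof (rule ccontr)
  define U where "U = {\<xi> :: 'n pt. 1 < rr \<xi> \<and> rr \<xi> < exp 1 \<and> \<bar>tc \<xi>\<bar> < T}"
  have oU: "open U"
    unfolding U_def by (intro open_Collect_conj open_Collect_less continuous_intros)
  have "exp 1 > (2::real)" using exp_lower_Taylor_quadratic[of 1] by simp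
  \<comment> \<open>A witness with r = 2, which lies strictly between 1 and exp 1, and t =
    0.\<close>
  then have "(2 *\<^sub>R axis undefined 1, 0, 0) \<in> U"
    using T by (simp add: U_def rr_def xc_def yc_def tc_def norm_axis_1)
  then have neU: "U \<noteq> {}" by blast
  assume "\<not> 0 < (\<integral>\<^sup>+\<xi>\<in>shell. ennreal (g (tc \<xi>)) \<partial>(hmeas :: 'n pt measure))"
  then have "(\<integral>\<^sup>+\<xi>. ennreal (rr \<xi> powr (- (2 * real CARD('n)))) * (ennreal (g (tc \<xi>)) * indicator shell \<xi>) \<partial>(lborel :: 'n pt measure)) = 0"
    by (subst nn_integral_hmeas[symmetric]) (auto simp: not_less)
  then have "AE \<xi> in (lborel :: 'n pt measure). ennreal (rr \<xi> powr (- (2 * real CARD('n)))) * (ennreal (g (tc \<xi>)) * indicator shell \<xi>) = 0"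
    by (subst (asm) nn_integral_0_iff_AE) auto
  then have "AE \<xi> in (lborel :: 'n pt measure). \<xi> \<notin> U"
    by (rule eventually_mono) (use g in \<open>auto simp: U_def shell_def indicator_def ennreal_zero_less_mult_iff split: if_splits dest!: g\<close>)
  then have "U \<in> null_sets lborel"
    using oU by (subst AE_iff_null_sets) auto
  then have "negligible U"
    by (simp add: negligible_iff_null_sets null_sets_completionI)
  then show False using open_not_negligible[OF oU neU] by blast
qed

section \<open>Sharpness\<close>

text \<open>The two limits are what the test functions require. \<open>lim\<tau>\<close> provides
  arbitrarily long \<tau>-intervals near the axis, so the slope of a cut-off can be made small
  compared with its mass. \<open>lim\<tau>'\<close> compares the t-part of r times the gradient, of
  order exp (2 \<gamma> s), with the radial part, of order \<open>\<tau>'\<close>.\<close>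

theorem hardy_weighted_sharp:
  fixes \<Omega> :: "'n::finite pt set" and \<tau> \<tau>' V Z :: "real \<Rightarrow> real" and p d L \<gamma> \<rho> C :: real
  assumes p: "1 < p" and \<gamma>: "0 \<le> \<gamma>"
    and \<tau>: "\<And>s. s < L \<Longrightarrow> (\<tau> has_real_derivative \<tau>' s) (at s)"
    and \<tau>': "continuous_on {..<L} \<tau>'" and pos: "\<And>s. s < L \<Longrightarrow> 0 < \<tau>' s"
    and V: "\<And>s. s < L \<Longrightarrow> V s = exp (p * d * \<tau> s) * \<tau>' s"
    and Z: "\<And>s. s < L \<Longrightarrow> Z s = exp (p * d * \<tau> s) * \<tau>' s powr (1 - p)"
    and lim\<tau>: "filterlim \<tau> at_bot at_bot"
    and lim\<tau>': "((\<lambda>s. exp (2 * \<gamma> * s) / \<tau>' s) \<longlongrightarrow> 0) at_bot"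
    and \<rho>: "0 < \<rho>" and sub: "{\<xi>. 0 < rr \<xi> \<and> rr \<xi> < \<rho> \<and> \<bar>tc \<xi>\<bar> < \<rho>} \<subseteq> \<Omega>"
    and C: "\<bar>d\<bar> powr p < C"
  shows "\<exists>u\<in>C1_0 \<Omega>. \<not> ennreal C * (\<integral>\<^sup>+\<xi>\<in>\<Omega>. ennreal (\<bar>u \<xi>\<bar> powr p * V (ln (rr \<xi>))) \<partial>hmeas)
    \<le> (\<integral>\<^sup>+\<xi>\<in>\<Omega>. ennreal ((rr \<xi> * gradL_norm \<gamma> u \<xi>) powr p * Z (ln (rr \<xi>))) \<partial>hmeas)"
proof -
  \<comment> \<open>Test functions \<open>f (ln r) \<psi> (t)\<close>, where \<open>f\<close> is the virtual extremal \<open>exp (- d \<tau>)\<close> cut off on a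
    \<open>\<tau>\<close>-interval of length \<open>k = 1 / x\<close> so close to the axis that the \<open>\<partial>\<^sub>t\<close>-part of the
    gradient is negligible.\<close>
  define \<psi> where "\<psi> t = bump (2 / \<rho> * t)" for t
  define \<psi>' where "\<psi>' t = 2 / \<rho> * bump' (2 / \<rho> * t)" for t
  have d\<psi>: "(\<psi> has_real_derivative \<psi>' t) (at t)" for t
    unfolding \<psi>_def[abs_def] \<psi>'_def
    using DERIV_chain2[OF has_real_derivative_bump DERIV_cmult_Id, of "2 / \<rho>" t UNIV]
    by (simp only: mult.commute[of "2 / \<rho>" "bump' (2 / \<rho> * t)"])
  have c\<psi>: "continuous_on UNIV \<psi>" "continuous_on UNIV \<psi>'"
    unfolding \<psi>_def[abs_def] \<psi>'_def[abs_def]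
    by (intro continuous_intros continuous_on_compose2[OF continuous_on_bump[of UNIV]]
        continuous_on_compose2[OF continuous_on_bump'[of UNIV]]; simp)+
  then have [measurable]: "\<psi> \<in> borel_measurable borel" "\<psi>' \<in> borel_measurable borel"
    by (auto intro: borel_measurable_continuous_onI)
  have \<psi>0: "\<psi> t = 0" "\<psi>' t = 0" if "\<rho> / 2 < \<bar>t\<bar>" for t
    using that \<rho> bump_eq_0[of "2 / \<rho> * t"] bump'_eq_0[of "2 / \<rho> * t"]
    by (auto simp: \<psi>_def \<psi>'_def abs_mult field_simps)
  have \<psi>n: "0 \<le> \<psi> t" "\<psi> t \<le> 1" for t by (auto simp: \<psi>_def bump_nonneg bump_le_1)
  define M where "M = (\<integral>\<^sup>+\<xi>\<in>shell. ennreal (\<psi> (tc \<xi>) powr p) \<partial>(hmeas :: 'n pt measure))"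
  define M' where "M' = (\<integral>\<^sup>+\<xi>\<in>shell. ennreal (\<bar>\<psi>' (tc \<xi>)\<bar> powr p) \<partial>(hmeas :: 'n pt measure))"
  have "M < \<infinity>"
    unfolding M_def
    by (rule shell_slab_integral_finite[where g = "\<lambda>t. \<psi> t powr p" and T = "\<rho> / 2" and B = 1])
      (use p \<psi>0 \<psi>n powr_mono2[of p _ 1] in auto)
  moreover have "0 < M"
    unfolding M_def
  proof (rule shell_slab_integral_pos[where g = "\<lambda>t. \<psi> t powr p" and T = "\<rho> / 4"])
    fix t assume "\<bar>t\<bar> < \<rho> / 4"
    then have "1 / 2 \<le> \<psi> t" unfolding \<psi>_def using \<rho> by (intro bump_ge_half) (auto simp: abs_mult field_simps)
    then show "0 < \<psi> t powr p" by simp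
  qed (use \<rho> in auto)
  ultimately obtain m where m: "M = ennreal m" "0 < m"
    by (cases M) auto
  have "M' < \<infinity>"
    unfolding M'_def
  proof (rule shell_slab_integral_finite[where g = "\<lambda>t. \<bar>\<psi>' t\<bar> powr p" and T = "\<rho> / 2" and B = "(8 / \<rho>) powr p"])
    show "\<bar>\<psi>' t\<bar> powr p \<le> (8 / \<rho>) powr p" for t
      using p \<rho> abs_bump'_le[of "2 / \<rho> * t"] by (intro powr_mono2) (auto simp: \<psi>'_def abs_mult field_simps)
  qed (use p \<psi>0 in auto)
  then obtain m' where m': "M' = ennreal m'" "0 \<le> m'"
    by (cases M') auto

  \<comment> \<open>Order of choice: first \<open>e\<close>, which spends part of the gap below
    \<open>C\<close> on separating the main term from the errors, then \<open>x\<close>, which makes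
    the errors small, and finally the position \<open>s1\<close>.\<close>
  have "((\<lambda>e. (1 + e) powr p * \<bar>d\<bar> powr p) \<longlongrightarrow> (1 + 0) powr p * \<bar>d\<bar> powr p) (at_right 0)"
    by (intro tendsto_intros) auto
  then have "\<forall>\<^sub>F e in at_right 0. (1 + e) powr p * \<bar>d\<bar> powr p < C"
    using C by (intro order_tendstoD(2)) auto
  then have "\<forall>\<^sub>F e in at_right 0. 0 < e \<and> (1 + e) powr p * \<bar>d\<bar> powr p < C"
    using eventually_at_right_less by (rule eventually_conj[rotated])
  then obtain e where e: "0 < e" "(1 + e) powr p * \<bar>d\<bar> powr p < C"
    using eventually_happens' trivial_limit_at_right_real by blast
  \<comment> \<open>Two applications of \<open>add_powr_le\<close>: the first factor comes from
    splitting off the main term with parameter \<open>e\<close>, the second from separating the two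
    errors with parameter 1.\<close>
  define K where "K = (1 + 1 / e) powr p * 2 powr p"
  \<comment> \<open>An upper bound for the gradient side per unit of cut-off mass \<open>X'\<close>:
    main term, slope of the cut-off, t-derivative. Since the slope is at most 8 / k, the slope mass
    is at most (8 / k)^p k, while the cut-off mass is at least 2^(-p) k / 2. Their quotient is at
    most 2 (16 / k)^p, and k = 1 / x.\<close>
  define E where "E x = (1 + e) powr p * \<bar>d\<bar> powr p * m
      + K * ((16 * x) powr p * 2 * m) + K * (2 * \<gamma> * x) powr p * m'" for x
  have "(E \<longlongrightarrow> (1 + e) powr p * \<bar>d\<bar> powr p * m
      + K * ((16 * 0) powr p * 2 * m) + K * (2 * \<gamma> * 0) powr p * m') (at_right 0)"
    unfolding E_def[abs_def] using p \<gamma> eventually_at_right_less[of 0]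
    by (intro tendsto_intros) (auto elim!: eventually_mono)
  then have "\<forall>\<^sub>F x in at_right 0. E x < C * m"
    using e m(2) p by (intro order_tendstoD(2)) auto
  then have "\<forall>\<^sub>F x in at_right 0. 0 < x \<and> E x < C * m"
    using eventually_at_right_less by (rule eventually_conj[rotated])
  then obtain x where x: "0 < x" "E x < C * m"
    using eventually_happens' trivial_limit_at_right_real by blast

  have "\<forall>\<^sub>F s in at_bot. exp (2 * \<gamma> * s) / \<tau>' s < x"
    using lim\<tau>' x(1) by (rule order_tendstoD(2))
  moreover have "\<forall>\<^sub>F s in at_bot. s < min L (ln \<rho>)"
    by (rule eventually_gt_at_bot)
  ultimately have "\<forall>\<^sub>F s in at_bot. exp (2 * \<gamma> * s) / \<tau>' s < x \<and> s < min L (ln \<rho>)"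
    by (rule eventually_conj)
  \<comment> \<open>Left of \<open>s1\<close> three things hold at once: \<open>\<tau>\<close> is
    regular, r is below \<open>\<rho>\<close>, and r^(2\<gamma>) is at most x times
    \<open>\<tau>'\<close>.\<close>
  then obtain s1 where s1: "\<And>s. s \<le> s1 \<Longrightarrow> exp (2 * \<gamma> * s) / \<tau>' s < x \<and> s < min L (ln \<rho>)"
    by (auto simp: eventually_at_bot_linorder)
  have s1L: "s1 < L" using s1[of s1] by auto
  have mono: "\<tau> s < \<tau> s'" if "s < s'" "s' < L" for s s'
    using that by (intro DERIV_pos_imp_increasing[OF that(1)]) (meson \<tau> pos order.strict_trans1)
  have mono_le: "\<tau> s \<le> \<tau> s'" if "s \<le> s'" "s' < L" for s s'
    using mono[of s s'] that by (cases "s = s'") auto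
  \<comment> \<open>This allows points to be prescribed by their value of
    \<open>\<tau>\<close>.\<close>
  have IVT: "\<exists>s\<le>s1. \<tau> s = v" if v: "v \<le> \<tau> s1" for v
  proof -
    have "\<forall>\<^sub>F s in at_bot. \<tau> s \<le> v" using lim\<tau> by (simp add: filterlim_at_bot)
    then obtain s' where "\<And>s. s \<le> s' \<Longrightarrow> \<tau> s \<le> v" by (auto simp: eventually_at_bot_linorder)
    then have s': "\<tau> (min s' s1) \<le> v" "min s' s1 \<le> s1" by auto
    have "continuous_on {min s' s1..s1} \<tau>"
      using s1L \<tau> by (intro continuous_at_imp_continuous_on ballI) (meson DERIV_isCont atLeastAtMost_iff order.strict_trans1)
    from IVT'[OF s'(1) v s'(2) this] show ?thesis by auto
  qed
  \<comment> \<open>In the variable \<tau> the cut-off is centred at \<open>c\<close> and supported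
    in an interval of length \<open>k\<close>, from \<open>s0\<close> to \<open>s1\<close>. The
    points \<open>sa\<close> and \<open>sb\<close> delimit its middle half, where it is at least
    1/2.\<close>
  define k where "k = 1 / x"
  define c where "c = \<tau> s1 - k / 2"
  have k: "0 < k" using x by (simp add: k_def)
  obtain s0 where s0: "s0 \<le> s1" "\<tau> s0 = c - k / 2" using IVT[of "c - k / 2"] k by (auto simp: c_def)
  obtain sa where sa: "sa \<le> s1" "\<tau> sa = c - k / 4" using IVT[of "c - k / 4"] k by (auto simp: c_def)
  obtain sb where sb: "sb \<le> s1" "\<tau> sb = c + k / 4" using IVT[of "c + k / 4"] k by (auto simp: c_def)
  have sab: "sa \<le> sb" using mono_le[of sb sa] sa sb s1L k by (cases "sa \<le> sb") auto

  define \<phi> where "\<phi> s = bump (2 / k * (\<tau> s - c))" for s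
  define \<phi>' where "\<phi>' s = 2 / k * bump' (2 / k * (\<tau> s - c))" for s
  have absk: "\<bar>2 / k * z\<bar> = 2 / k * \<bar>z\<bar>" for z using k by (simp add: abs_mult)
  have far: "1 \<le> \<bar>2 / k * (\<tau> s - c)\<bar>" if "s < L" "s \<le> s0 \<or> s1 \<le> s" for s
  proof -
    have "\<tau> s \<le> c - k / 2 \<or> c + k / 2 \<le> \<tau> s"
      using that mono_le[of s s0] mono_le[of s1 s] s0 s1L by (auto simp: c_def)
    then have "k / 2 \<le> \<bar>\<tau> s - c\<bar>" by (elim disjE) linarith+
    then have "2 / k * (k / 2) \<le> 2 / k * \<bar>\<tau> s - c\<bar>" using k by (intro mult_left_mono) auto
    moreover have "2 / k * (k / 2) = 1" using k by simp
    ultimately show ?thesis unfolding absk by linarith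
  qed
  have \<phi>0: "\<phi> s = 0" "\<phi>' s = 0" if "s < L" "s \<le> s0 \<or> s1 \<le> s" for s
    using far[OF that] by (auto simp: \<phi>_def \<phi>'_def bump_eq_0 bump'_eq_0)
  have \<phi>n: "0 \<le> \<phi> s" "\<phi> s \<le> 1" for s by (auto simp: \<phi>_def bump_nonneg bump_le_1)
  have \<phi>'B: "\<bar>\<phi>' s\<bar> \<le> 8 / k" for s
    using k abs_bump'_le[of "2 / k * (\<tau> s - c)"] by (simp add: \<phi>'_def abs_mult field_simps)
  have d\<phi>: "(\<phi> has_real_derivative \<phi>' s * \<tau>' s) (at s)" if "s < L" for s
  proof -
    have "((\<lambda>s. 2 / k * (\<tau> s - c)) has_real_derivative 2 / k * \<tau>' s) (at s)"
      by (rule derivative_eq_intros \<tau>[OF that] refl)+ simp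
    from DERIV_chain2[OF has_real_derivative_bump this] show ?thesis
      unfolding \<phi>_def[abs_def] \<phi>'_def by (simp add: mult_ac)
  qed
  have c\<tau>: "continuous_on {..<L} \<tau>"
    using \<tau> by (intro continuous_at_imp_continuous_on ballI) (meson DERIV_isCont lessThan_iff)
  have c\<phi>: "continuous_on {..<L} \<phi>" "continuous_on {..<L} \<phi>'"
    unfolding \<phi>_def[abs_def] \<phi>'_def[abs_def]
    by (intro continuous_intros c\<tau> continuous_on_compose2[OF continuous_on_bump[of UNIV]]
        continuous_on_compose2[OF continuous_on_bump'[of UNIV]]; simp)+
  \<comment> \<open>The cut-off already vanishes from \<open>s1\<close> on, and s1 < L, so
    continuing by zero beyond \<open>L\<close> creates no singularity.\<close>
  define f where "f s = (if s < L then exp (- d * \<tau> s) * \<phi> s else 0)" for s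
  define f' where "f' s = (if s < L then \<tau>' s * exp (- d * \<tau> s) * (\<phi>' s - d * \<phi> s) else 0)" for s
  have f0: "f s = 0" "f' s = 0" if "s \<le> s0 \<or> s1 \<le> s" for s
    using \<phi>0 that by (auto simp: f_def f'_def)
  have df: "(f has_real_derivative f' s) (at s)" for s
  proof (cases "s < L")
    case True
    have "((\<lambda>s. exp (- d * \<tau> s) * \<phi> s) has_real_derivative f' s) (at s)"
      by (rule derivative_eq_intros \<tau>[OF True] d\<phi>[OF True] refl)+ (simp add: f'_def True algebra_simps)
    then show ?thesis
      by (rule has_field_derivative_transform_within_open[where S = "{..<L}"]) (use True in \<open>auto simp: f_def\<close>)
  next
    case False
    have "((\<lambda>_. 0) has_real_derivative f' s) (at s)" using False by (simp add: f'_def)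
    then show ?thesis
      by (rule has_field_derivative_transform_within_open[where S = "{s1<..}"]) (use False s1L f0 in auto)
  qed
  have cf': "continuous_on UNIV f'"
  proof -
    have "continuous_on ({..<L} \<union> {s1<..}) f'"
    proof (rule continuous_on_open_Un)
      have "continuous_on {..<L} (\<lambda>s. \<tau>' s * exp (- d * \<tau> s) * (\<phi>' s - d * \<phi> s))"
        by (intro continuous_intros \<tau>' c\<tau> c\<phi>)
      then show "continuous_on {..<L} f'" by (rule continuous_on_eq) (auto simp: f'_def)
      show "continuous_on {s1<..} f'"
        by (rule continuous_on_eq[OF continuous_on_const[of _ 0]]) (simp add: f0)
    qed auto
    moreover have "{..<L} \<union> {s1<..} = UNIV" using s1L by auto
    ultimately show ?thesis by simp
  qed
  define u :: "'n pt \<Rightarrow> real" where "u = separated f \<psi>"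
  have u: "u \<in> C1_0 \<Omega>"
    unfolding u_def
  proof (rule separated_C1_0[OF df cf' d\<psi> c\<psi>(2), where a = s0 and b = s1 and T = "\<rho> / 2"])
    have "exp s1 < \<rho>" using s1[of s1] \<rho> by (metis exp_less_cancel_iff exp_ln min_less_iff_conj order_refl)
    then show "{\<xi>. exp s0 \<le> rr \<xi> \<and> rr \<xi> \<le> exp s1 \<and> \<bar>tc \<xi>\<bar> \<le> \<rho> / 2} \<subseteq> \<Omega>"
      using \<rho> by (intro order_trans[OF _ sub]) (auto intro: order.strict_trans2[OF exp_gt_zero])
  qed (use f0 \<psi>0 in auto)

  \<comment> \<open>The power p of exp (- d \<tau>) cancels the exponential in the weights. What
    remains are integrals of the cut-off and of its slope against d\<tau>; \<open>hX\<close>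
    measures the mass and \<open>hY\<close> the slope.\<close>
  define hX where "hX s = indicator {..<L} s *\<^sub>R (\<phi> s powr p * \<tau>' s)" for s
  define hY where "hY s = indicator {..<L} s *\<^sub>R (\<bar>\<phi>' s\<bar> powr p * \<tau>' s)" for s
  have [measurable]: "hX \<in> borel_measurable borel" "hY \<in> borel_measurable borel"
    unfolding hX_def[abs_def] hY_def[abs_def] using p \<phi>n
    by (intro borel_measurable_continuous_on_indicator continuous_intros \<tau>' c\<phi> continuous_on_powr'; auto)+
  have hn: "0 \<le> hX s" "0 \<le> hY s" for s
    using pos by (auto simp: hX_def hY_def indicator_def less_imp_le)
  have int\<tau>': "(\<integral>\<^sup>+s\<in>{a..b}. ennreal (q * \<tau>' s) \<partial>lborel) = ennreal (q * (\<tau> b - \<tau> a))"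
    if "a \<le> b" "b < L" "0 \<le> q" for a b q
  proof (rule nn_integral_has_integral_lebesgue')
    show "0 \<le> q * \<tau>' s" if "s \<in> {a..b}" for s using pos[of s] that \<open>0 \<le> q\<close> \<open>b < L\<close> by simp
    have "(\<tau>' has_integral (\<tau> b - \<tau> a)) {a..b}"
      using \<tau> that by (intro fundamental_theorem_of_calculus)
        (auto simp: has_real_derivative_iff_has_vector_derivative[symmetric] intro: has_field_derivative_at_within)
    then show "((\<lambda>s. q * \<tau>' s) has_integral q * (\<tau> b - \<tau> a)) {a..b}"
      by (rule has_integral_mult_right)
  qed
  define X where "X = (\<integral>\<^sup>+s. ennreal (hX s) \<partial>lborel)"
  define Y where "Y = (\<integral>\<^sup>+s. ennreal (hY s) \<partial>lborel)"
  have \<phi>supp: "\<phi> s = 0" "\<phi>' s = 0" if "s \<notin> {s0..s1}" "s < L" for s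
    using \<phi>0[of s] that by auto
  have "X \<le> (\<integral>\<^sup>+s\<in>{s0..s1}. ennreal (1 * \<tau>' s) \<partial>lborel)"
    unfolding X_def
  proof (rule nn_integral_mono)
    fix s
    have "\<phi> s powr p * \<tau>' s \<le> 1 * \<tau>' s" if "s < L"
      using that pos[OF that] p powr_mono2[of p "\<phi> s" 1] \<phi>n[of s] by (intro mult_right_mono) auto
    then show "ennreal (hX s) \<le> ennreal (1 * \<tau>' s) * indicator {s0..s1} s"
      using \<phi>supp[of s] by (auto simp: hX_def indicator_def intro!: ennreal_leI)
  qed
  also have "\<dots> = ennreal k" using s0 s1L by (subst int\<tau>') (auto simp: c_def)
  finally obtain X' where X': "X = ennreal X'" "0 \<le> X'" by (cases X) (auto simp: top_unique)
  \<comment> \<open>The middle half has \<tau>-length k / 2, and there the cut-off to the power p is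
    at least 2^(-p).\<close>
  have "ennreal (2 powr - p * (k / 2)) = (\<integral>\<^sup>+s\<in>{sa..sb}. ennreal (2 powr - p * \<tau>' s) \<partial>lborel)"
    using sab sa sb s1L by (subst int\<tau>') auto
  also have "\<dots> \<le> X"
    unfolding X_def
  proof (rule nn_integral_mono)
    fix s
    have "2 powr - p * \<tau>' s \<le> hX s" if s: "s \<in> {sa..sb}"
    proof -
      have sL: "s < L" using s sb s1L by auto
      have "\<tau> sa \<le> \<tau> s" "\<tau> s \<le> \<tau> sb"
        using mono_le[of sa s] mono_le[of s sb] s sb s1L sL by auto
      then have "\<bar>\<tau> s - c\<bar> \<le> k / 4" using sa sb by linarith
      then have "2 / k * \<bar>\<tau> s - c\<bar> \<le> 2 / k * (k / 4)" using k by (intro mult_left_mono) auto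
      moreover have "2 / k * (k / 4) = 1 / 2" using k by simp
      ultimately have "1 / 2 \<le> \<phi> s"
        unfolding \<phi>_def by (intro bump_ge_half) (unfold absk, linarith)
      then have "(1 / 2) powr p \<le> \<phi> s powr p" using p by (intro powr_mono2) auto
      also have "(1 / 2) powr p = 2 powr - p" by (simp add: powr_divide powr_minus_divide)
      finally show ?thesis using sL pos[OF sL] by (simp add: hX_def)
    qed
    then show "ennreal (2 powr - p * \<tau>' s) * indicator {sa..sb} s \<le> ennreal (hX s)"
      by (auto simp: indicator_def intro!: ennreal_leI)
  qed
  finally have X'lb: "2 powr - p * (k / 2) \<le> X'" using X' by simp
  then have X'pos: "0 < X'" using k by (smt (verit) powr_gt_zero mult_pos_pos half_gt_zero)
  have "Y \<le> (\<integral>\<^sup>+s\<in>{s0..s1}. ennreal ((8 / k) powr p * \<tau>' s) \<partial>lborel)"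
    unfolding Y_def
  proof (rule nn_integral_mono)
    fix s
    have "\<bar>\<phi>' s\<bar> powr p * \<tau>' s \<le> (8 / k) powr p * \<tau>' s" if "s < L"
      using that pos[OF that] p \<phi>'B[of s] by (intro mult_right_mono powr_mono2) auto
    then show "ennreal (hY s) \<le> ennreal ((8 / k) powr p * \<tau>' s) * indicator {s0..s1} s"
      using \<phi>supp[of s] by (auto simp: hY_def indicator_def intro!: ennreal_leI)
  qed
  also have "\<dots> = ennreal ((8 / k) powr p * k)" using s0 s1L by (subst int\<tau>') (auto simp: c_def)
  also have "\<dots> \<le> ennreal ((16 * x) powr p * 2 * X')"
  proof (rule ennreal_leI)
    have "(8 / k) powr p = (16 * x / 2) powr p" by (simp add: k_def)
    also have "\<dots> = (16 * x) powr p * 2 powr - p"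
      by (simp only: powr_divide powr_minus_divide) simp
    finally have "(8 / k) powr p * k = (16 * x) powr p * 2 * (2 powr - p * (k / 2))" by simp
    also have "\<dots> \<le> (16 * x) powr p * 2 * X'"
      using X'lb by (intro mult_left_mono) auto
    finally show "(8 / k) powr p * k \<le> (16 * x) powr p * 2 * X'" .
  qed
  finally have YX: "Y \<le> ennreal ((16 * x) powr p * 2 * X')" .

  have prod: "(\<integral>\<^sup>+\<xi>. ennreal (h (ln (rr \<xi>))) * ennreal (g (tc \<xi>)) \<partial>(hmeas :: 'n pt measure))
      = (\<integral>\<^sup>+s. ennreal (h s) \<partial>lborel) * (\<integral>\<^sup>+\<xi>\<in>shell. ennreal (g (tc \<xi>)) \<partial>(hmeas :: 'n pt measure))"
    if [measurable]: "h \<in> borel_measurable borel" "g \<in> borel_measurable borel" for h g :: "real \<Rightarrow> real"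
    by (rule nn_integral_polar_product) measurable
  have uV: "\<bar>u \<xi>\<bar> powr p * V (ln (rr \<xi>)) = hX (ln (rr \<xi>)) * \<psi> (tc \<xi>) powr p" if r: "0 < rr \<xi>" for \<xi>
  proof (cases "ln (rr \<xi>) < L")
    case True
    define s where "s = ln (rr \<xi>)"
    have sL: "s < L" using True by (simp add: s_def)
    have "\<bar>u \<xi>\<bar> = exp (- d * \<tau> s) * \<phi> s * \<psi> (tc \<xi>)"
      using r sL \<phi>n \<psi>n by (simp add: u_def separated_def f_def s_def abs_mult)
    then have "\<bar>u \<xi>\<bar> powr p * V s = (exp (- d * \<tau> s) powr p * exp (p * d * \<tau> s)) * (\<phi> s powr p * \<tau>' s) * \<psi> (tc \<xi>) powr p"
      by (simp add: powr_mult V[OF sL])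
    also have "exp (- d * \<tau> s) powr p * exp (p * d * \<tau> s) = 1"
      by (simp add: exp_powr_real mult_exp_exp)
    finally show ?thesis using sL by (simp add: hX_def s_def)
  next
    case False
    then show ?thesis using r p by (simp add: u_def separated_def f_def hX_def)
  qed
  have u\<Omega>: "u \<xi> = 0" if "\<xi> \<notin> \<Omega>" for \<xi>
    using u that closure_subset[of "{\<xi>. u \<xi> \<noteq> 0}"] by (auto simp: C1_0_def)
  have "(\<integral>\<^sup>+\<xi>\<in>\<Omega>. ennreal (\<bar>u \<xi>\<bar> powr p * V (ln (rr \<xi>))) \<partial>hmeas)
      = (\<integral>\<^sup>+\<xi>. ennreal (hX (ln (rr \<xi>))) * ennreal (\<psi> (tc \<xi>) powr p) \<partial>(hmeas :: 'n pt measure))"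
  proof (rule nn_integral_cong_AE)
    have "ennreal (\<bar>u \<xi>\<bar> powr p * V (ln (rr \<xi>))) * indicator \<Omega> \<xi>
        = ennreal (hX (ln (rr \<xi>))) * ennreal (\<psi> (tc \<xi>) powr p)" if r: "0 < rr \<xi>" for \<xi>
      using uV[OF r] u\<Omega>[of \<xi>] p hn by (auto simp: indicator_def simp flip: ennreal_mult)
    then show "AE \<xi> in hmeas. ennreal (\<bar>u \<xi>\<bar> powr p * V (ln (rr \<xi>))) * indicator \<Omega> \<xi>
        = ennreal (hX (ln (rr \<xi>))) * ennreal (\<psi> (tc \<xi>) powr p)"
      using AE_hmeas_rr_pos by (auto elim: eventually_mono)
  qed
  also have "\<dots> = X * M"
    unfolding X_def M_def by (rule prod) measurable
  finally have I: "(\<integral>\<^sup>+\<xi>\<in>\<Omega>. ennreal (\<bar>u \<xi>\<bar> powr p * V (ln (rr \<xi>))) \<partial>hmeas) = X * M" .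

  define a1 where "a1 = (1 + e) powr p * \<bar>d\<bar> powr p"
  define a3 where "a3 = K * (2 * \<gamma> * x) powr p"
  have an: "0 \<le> a1" "0 \<le> K" "0 \<le> a3" by (auto simp: a1_def K_def a3_def)
  have uZ: "(rr \<xi> * gradL_norm \<gamma> u \<xi>) powr p * Z (ln (rr \<xi>))
      \<le> a1 * (hX (ln (rr \<xi>)) * \<psi> (tc \<xi>) powr p) + K * (hY (ln (rr \<xi>)) * \<psi> (tc \<xi>) powr p)
        + a3 * (hX (ln (rr \<xi>)) * \<bar>\<psi>' (tc \<xi>)\<bar> powr p)" (is "_ \<le> ?B") if r: "0 < rr \<xi>" for \<xi>
  proof -
    define s where "s = ln (rr \<xi>)"
    define t where "t = tc \<xi>"
    have gn: "0 \<le> rr \<xi> * gradL_norm \<gamma> u \<xi>"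
      by (auto simp: gradL_norm_def intro!: mult_nonneg_nonneg sum_nonneg)
    have g: "rr \<xi> * gradL_norm \<gamma> u \<xi> \<le> \<bar>f' s\<bar> * \<bar>\<psi> t\<bar> + 2 * \<gamma> * rr \<xi> powr (2 * \<gamma>) * \<bar>f s\<bar> * \<bar>\<psi>' t\<bar>"
      unfolding u_def s_def t_def
      by (rule gradL_norm_separated_le[OF df cf' d\<psi> c\<psi>(2) _ _ r \<gamma>, where a = s0 and b = s1 and T = "\<rho> / 2"])
        (use f0 \<psi>0 in auto)
    show ?thesis
    proof (cases "s < s1")
      \<comment> \<open>From \<open>s1\<close> on both \<open>f\<close> and \<open>f'\<close>
        vanish, hence so does the gradient. This disposes of s \<ge> L, where nothing is known about
        \<open>Z\<close>.\<close>
      case False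
      then have "rr \<xi> * gradL_norm \<gamma> u \<xi> = 0" using g gn f0[of s] by auto
      then have "(rr \<xi> * gradL_norm \<gamma> u \<xi>) powr p * Z (ln (rr \<xi>)) = 0"
        by (simp only: powr_eq_0_iff mult_eq_0_iff simp_thms)
      moreover have "0 \<le> ?B" using an hn by (simp add: add_nonneg_nonneg)
      ultimately show ?thesis by (simp only:)
    next
      case True
      then have sL: "s < L" using s1L by simp
      define \<theta> where "\<theta> = \<tau>' s"
      define w where "w = exp (- d * \<tau> s)"
      have \<theta>: "0 < \<theta>" and w: "0 < w" using pos[OF sL] by (auto simp: \<theta>_def w_def)
      \<comment> \<open>The contributions to r times the gradient after division by the common
        factor \<open>\<theta> * w\<close>: from differentiating exp (- d \<tau>), from
        differentiating the cut-off, and from the t-derivative. Only the first one carries the sharp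
        constant.\<close>
      define y1 where "y1 = \<bar>d\<bar> * \<phi> s * \<psi> t"
      define y2 where "y2 = \<bar>\<phi>' s\<bar> * \<psi> t"
      define y3 where "y3 = 2 * \<gamma> * x * \<phi> s * \<bar>\<psi>' t\<bar>"
      have yn: "0 \<le> y1" "0 \<le> y2" "0 \<le> y3"
        using \<phi>n \<psi>n \<gamma> x by (auto simp: y1_def y2_def y3_def)
      have "rr \<xi> powr (2 * \<gamma>) = exp (2 * \<gamma> * s)" using r by (simp add: powr_def s_def)
      then have rx: "rr \<xi> powr (2 * \<gamma>) \<le> x * \<theta>"
        using s1[of s] True \<theta> by (simp add: \<theta>_def field_simps)
      have "\<bar>f' s\<bar> * \<bar>\<psi> t\<bar> = \<theta> * w * \<bar>\<phi>' s - d * \<phi> s\<bar> * \<psi> t"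
        using sL \<theta> \<psi>n by (simp add: f'_def \<theta>_def w_def abs_mult)
      also have "\<dots> \<le> \<theta> * w * (\<bar>\<phi>' s\<bar> + \<bar>d\<bar> * \<phi> s) * \<psi> t"
        using \<theta> w \<psi>n[of t] \<phi>n[of s] abs_triangle_ineq4[of "\<phi>' s" "d * \<phi> s"]
        by (intro mult_right_mono mult_left_mono) (auto simp: abs_mult)
      finally have g1: "\<bar>f' s\<bar> * \<bar>\<psi> t\<bar> \<le> (y1 + y2) * (\<theta> * w)" by (simp add: y1_def y2_def algebra_simps)
      have "2 * \<gamma> * rr \<xi> powr (2 * \<gamma>) * \<bar>f s\<bar> * \<bar>\<psi>' t\<bar> \<le> 2 * \<gamma> * (x * \<theta>) * \<bar>f s\<bar> * \<bar>\<psi>' t\<bar>"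
        using rx \<gamma> by (intro mult_right_mono mult_left_mono) auto
      also have "\<bar>f s\<bar> = w * \<phi> s" using sL \<phi>n by (simp add: f_def w_def abs_mult)
      finally have g2: "2 * \<gamma> * rr \<xi> powr (2 * \<gamma>) * \<bar>f s\<bar> * \<bar>\<psi>' t\<bar> \<le> y3 * (\<theta> * w)"
        by (simp add: y3_def mult_ac \<open>\<bar>f s\<bar> = w * \<phi> s\<close>)
      have "rr \<xi> * gradL_norm \<gamma> u \<xi> \<le> (y1 + (y2 + y3)) * (\<theta> * w)"
        using g g1 g2 by (simp add: algebra_simps)
      then have "(rr \<xi> * gradL_norm \<gamma> u \<xi>) powr p * Z s \<le> ((y1 + (y2 + y3)) * (\<theta> * w)) powr p * Z s"
        using gn p by (intro mult_right_mono powr_mono2) (auto simp: Z[OF sL])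
      also have "\<dots> = (y1 + (y2 + y3)) powr p * (w powr p * exp (p * d * \<tau> s)) * (\<theta> powr p * \<theta> powr (1 - p))"
        by (simp add: powr_mult Z[OF sL] \<theta>_def)
      also have "w powr p * exp (p * d * \<tau> s) = 1"
        by (simp add: w_def exp_powr_real mult_exp_exp)
      also have "\<theta> powr p * \<theta> powr (1 - p) = \<theta>"
        using \<theta> by (simp flip: powr_add)
      finally have 1: "(rr \<xi> * gradL_norm \<gamma> u \<xi>) powr p * Z s \<le> (y1 + (y2 + y3)) powr p * \<theta>" by simp
      have "(y2 + y3) powr p \<le> 2 powr p * y2 powr p + 2 powr p * y3 powr p"
        using add_powr_le[of y2 y3 1 p] yn p by simp
      then have "(1 + 1 / e) powr p * (y2 + y3) powr p \<le> (1 + 1 / e) powr p * (2 powr p * y2 powr p + 2 powr p * y3 powr p)"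
        by (intro mult_left_mono) auto
      then have "(y1 + (y2 + y3)) powr p \<le> (1 + e) powr p * y1 powr p + (K * y2 powr p + K * y3 powr p)"
        using add_powr_le[of y1 "y2 + y3" e p] yn p e(1) by (simp add: K_def algebra_simps)
      then have "(y1 + (y2 + y3)) powr p * \<theta> \<le> ((1 + e) powr p * y1 powr p + (K * y2 powr p + K * y3 powr p)) * \<theta>"
        using \<theta> by (intro mult_right_mono) auto
      also have "\<dots> = a1 * (hX s * \<psi> t powr p) + K * (hY s * \<psi> t powr p) + a3 * (hX s * \<bar>\<psi>' t\<bar> powr p)"
        using sL by (simp add: a1_def a3_def hX_def hY_def y1_def y2_def y3_def \<theta>_def powr_mult algebra_simps)
      finally show ?thesis using 1 by (simp add: s_def t_def)
    qed
  qed
  have "(\<integral>\<^sup>+\<xi>\<in>\<Omega>. ennreal ((rr \<xi> * gradL_norm \<gamma> u \<xi>) powr p * Z (ln (rr \<xi>))) \<partial>hmeas)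
    \<le> (\<integral>\<^sup>+\<xi>. ennreal a1 * (ennreal (hX (ln (rr \<xi>))) * ennreal (\<psi> (tc \<xi>) powr p))
        + ennreal K * (ennreal (hY (ln (rr \<xi>))) * ennreal (\<psi> (tc \<xi>) powr p))
        + ennreal a3 * (ennreal (hX (ln (rr \<xi>))) * ennreal (\<bar>\<psi>' (tc \<xi>)\<bar> powr p)) \<partial>(hmeas :: 'n pt measure))"
  proof (rule nn_integral_mono_AE)
    have "ennreal ((rr \<xi> * gradL_norm \<gamma> u \<xi>) powr p * Z (ln (rr \<xi>))) * indicator \<Omega> \<xi>
        \<le> ennreal a1 * (ennreal (hX (ln (rr \<xi>))) * ennreal (\<psi> (tc \<xi>) powr p))
        + ennreal K * (ennreal (hY (ln (rr \<xi>))) * ennreal (\<psi> (tc \<xi>) powr p))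
        + ennreal a3 * (ennreal (hX (ln (rr \<xi>))) * ennreal (\<bar>\<psi>' (tc \<xi>)\<bar> powr p))" if r: "0 < rr \<xi>" for \<xi>
    proof -
      have "ennreal ((rr \<xi> * gradL_norm \<gamma> u \<xi>) powr p * Z (ln (rr \<xi>))) * indicator \<Omega> \<xi>
        \<le> ennreal ((rr \<xi> * gradL_norm \<gamma> u \<xi>) powr p * Z (ln (rr \<xi>)))"
        by (simp add: indicator_def)
      also note ennreal_leI[OF uZ[OF r]]
      finally show ?thesis using an hn by (simp add: ennreal_plus ennreal_mult)
    qed
    then show "AE \<xi> in hmeas. ennreal ((rr \<xi> * gradL_norm \<gamma> u \<xi>) powr p * Z (ln (rr \<xi>))) * indicator \<Omega> \<xi>
        \<le> ennreal a1 * (ennreal (hX (ln (rr \<xi>))) * ennreal (\<psi> (tc \<xi>) powr p))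
        + ennreal K * (ennreal (hY (ln (rr \<xi>))) * ennreal (\<psi> (tc \<xi>) powr p))
        + ennreal a3 * (ennreal (hX (ln (rr \<xi>))) * ennreal (\<bar>\<psi>' (tc \<xi>)\<bar> powr p))"
      using AE_hmeas_rr_pos by (auto elim: eventually_mono)
  qed
  also have "\<dots> = ennreal a1 * (X * M) + ennreal K * (Y * M) + ennreal a3 * (X * M')"
    unfolding X_def Y_def M_def M'_def
    by (simp add: nn_integral_add nn_integral_cmult prod[of hX "\<lambda>t. \<psi> t powr p"]
        prod[of hY "\<lambda>t. \<psi> t powr p"] prod[of hX "\<lambda>t. \<bar>\<psi>' t\<bar> powr p"])
  also have "\<dots> \<le> ennreal a1 * (X * M) + ennreal K * (ennreal ((16 * x) powr p * 2 * X') * M) + ennreal a3 * (X * M')"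
    by (intro add_mono mult_left_mono mult_right_mono YX order_refl) auto
  also have "\<dots> = ennreal (a1 * (X' * m) + K * ((16 * x) powr p * 2 * X' * m) + a3 * (X' * m'))"
    using X' m m' an by (simp add: ennreal_plus ennreal_mult)
  also have "\<dots> = ennreal (X' * E x)"
    by (simp add: E_def a1_def a3_def algebra_simps)
  finally have J: "(\<integral>\<^sup>+\<xi>\<in>\<Omega>. ennreal ((rr \<xi> * gradL_norm \<gamma> u \<xi>) powr p * Z (ln (rr \<xi>))) \<partial>hmeas) \<le> ennreal (X' * E x)" .
  have "0 < C" using C powr_ge_zero[of "\<bar>d\<bar>" p] by linarith
  then have "ennreal C * (X * M) = ennreal (X' * (C * m))"
    using X' m by (simp add: mult_ac flip: ennreal_mult)
  moreover have "ennreal (X' * E x) < ennreal (X' * (C * m))"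
    using X'pos x m \<open>0 < C\<close> by (intro ennreal_lessI mult_strict_left_mono) (auto intro!: mult_pos_pos)
  ultimately have lt: "ennreal (X' * E x) < ennreal C * (X * M)" by simp
  show ?thesis
    by (rule bexI[OF _ u], unfold I not_le, rule order.strict_trans1[OF J lt])
qed

section \<open>Power and logarithmic weights\<close>

text \<open>The axis lies in a coordinate hyperplane. The Lebesgue version is needed to compare
  integrands off the axis, where no division by zero occurs.\<close>

lemma AE_rr_pos: "AE \<xi> in (lborel :: 'n::finite pt measure). 0 < rr \<xi>"
proof -
  have [simp]: "{\<xi> :: 'n pt. rr \<xi> = 0} \<in> sets borel" by measurable
  have "negligible {\<xi> :: 'n pt. (axis undefined 1, 0, 0) \<bullet> \<xi> = 0}"
    by (rule negligible_hyperplane) (simp add: zero_prod_def axis_eq_0_iff)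
  moreover have "{\<xi> :: 'n pt. rr \<xi> = 0} \<subseteq> {\<xi>. (axis undefined 1, 0, 0) \<bullet> \<xi> = 0}"
    by (auto simp: rr_def xc_def add_nonneg_eq_0_iff)
  ultimately have "negligible {\<xi> :: 'n pt. rr \<xi> = 0}"
    by (rule negligible_subset)
  then have "{\<xi> :: 'n pt. rr \<xi> = 0} \<in> null_sets lborel"
    by (simp add: negligible_iff_null_sets null_sets_completion_iff)
  then have "AE \<xi> in (lborel :: 'n pt measure). \<xi> \<notin> {\<xi>. rr \<xi> = 0}"
    by (subst AE_iff_null_sets[symmetric]) auto
  then show ?thesis by (rule eventually_mono) (simp add: less_le)
qed

lemma rr_le_NN:
  assumes "0 < \<gamma>" shows "rr \<xi> \<le> NN \<gamma> \<xi>"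
proof -
  have "rr \<xi> = (rr \<xi> powr (4 * \<gamma>)) powr (1 / (4 * \<gamma>))"
    using assms by (simp add: powr_powr)
  also have "\<dots> \<le> NN \<gamma> \<xi>"
    unfolding NN_def using assms by (intro powr_mono2) auto
  finally show ?thesis .
qed

lemma set_nn_integral_lborel_eq_hmeas:
  fixes F G :: "'n::finite pt \<Rightarrow> real"
  assumes [measurable]: "G \<in> borel_measurable borel" "\<Omega> \<in> sets borel"
    and FG: "\<And>\<xi>. F \<xi> = rr \<xi> powr (- (2 * real CARD('n))) * G \<xi>"
  shows "(\<integral>\<^sup>+\<xi>\<in>\<Omega>. ennreal (F \<xi>) \<partial>lborel) = (\<integral>\<^sup>+\<xi>\<in>\<Omega>. ennreal (G \<xi>) \<partial>hmeas)"
  by (subst nn_integral_hmeas) (auto simp: FG ennreal_mult' mult.assoc)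

text \<open>One power r^p is absorbed into r times the gradient, so both sides carry the same weight
  r^\<beta>. Dividing out the density r^(-2n) of \<open>hmeas\<close> leaves the exponent 2n +
  \<beta>.\<close>

lemma power_weight_hmeas:
  fixes u :: "'n::finite pt \<Rightarrow> real" and \<beta> :: real
  assumes u: "u \<in> C1_0 \<Omega>" and \<Omega>: "open \<Omega>"
  defines "Q \<equiv> 2 * real CARD('n) + \<beta>"
  shows "(\<integral>\<^sup>+\<xi>\<in>\<Omega>. ennreal (\<bar>u \<xi>\<bar> powr p * rr \<xi> powr \<beta>) \<partial>lborel)
      = (\<integral>\<^sup>+\<xi>\<in>\<Omega>. ennreal (\<bar>u \<xi>\<bar> powr p * exp (Q * ln (rr \<xi>))) \<partial>hmeas)"
    and "(\<integral>\<^sup>+\<xi>\<in>\<Omega>. ennreal (gradL_norm \<gamma> u \<xi> powr p * rr \<xi> powr (p + \<beta>)) \<partial>lborel)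
      = (\<integral>\<^sup>+\<xi>\<in>\<Omega>. ennreal ((rr \<xi> * gradL_norm \<gamma> u \<xi>) powr p * exp (Q * ln (rr \<xi>))) \<partial>hmeas)"
proof -
  have [measurable]: "\<Omega> \<in> sets borel" using \<Omega> by simp
  have [measurable]: "u \<in> borel_measurable borel" "gradL_norm \<gamma> u \<in> borel_measurable borel"
    using C1_0_continuous[OF u \<Omega>] gradL_norm_borel[OF u \<Omega>]
    by (auto intro: borel_measurable_continuous_onI)
  \<comment> \<open>This includes the axis, where both powers of r are 0 by convention.\<close>
  have w: "rr \<xi> powr \<beta> = rr \<xi> powr (- (2 * real CARD('n))) * exp (Q * ln (rr \<xi>))" for \<xi> :: "'n pt"
    by (cases "rr \<xi> = 0") (auto simp: powr_def Q_def mult_exp_exp algebra_simps)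
  show "(\<integral>\<^sup>+\<xi>\<in>\<Omega>. ennreal (\<bar>u \<xi>\<bar> powr p * rr \<xi> powr \<beta>) \<partial>lborel)
      = (\<integral>\<^sup>+\<xi>\<in>\<Omega>. ennreal (\<bar>u \<xi>\<bar> powr p * exp (Q * ln (rr \<xi>))) \<partial>hmeas)"
    by (rule set_nn_integral_lborel_eq_hmeas) (auto simp: w)
  show "(\<integral>\<^sup>+\<xi>\<in>\<Omega>. ennreal (gradL_norm \<gamma> u \<xi> powr p * rr \<xi> powr (p + \<beta>)) \<partial>lborel)
      = (\<integral>\<^sup>+\<xi>\<in>\<Omega>. ennreal ((rr \<xi> * gradL_norm \<gamma> u \<xi>) powr p * exp (Q * ln (rr \<xi>))) \<partial>hmeas)"
    by (rule set_nn_integral_lborel_eq_hmeas) (auto simp: w powr_add powr_mult)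
qed

text \<open>The critical exponent p = 2n makes r^(-p) exactly the density of \<open>hmeas\<close>;
  no power of r is left over, and the weights are purely logarithmic.\<close>

lemma log_weight_hmeas:
  fixes u :: "'n::finite pt \<Rightarrow> real"
  assumes u: "u \<in> C1_0 \<Omega>" and \<Omega>: "open \<Omega>" and p: "p = 2 * real CARD('n)" and R: "0 < R"
  shows "(\<integral>\<^sup>+\<xi>\<in>\<Omega>. ennreal (\<bar>u \<xi>\<bar> powr p / rr \<xi> powr p * ln (R / rr \<xi>) powr b) \<partial>lborel)
      = (\<integral>\<^sup>+\<xi>\<in>\<Omega>. ennreal (\<bar>u \<xi>\<bar> powr p * (ln R - ln (rr \<xi>)) powr b) \<partial>hmeas)"
    and "(\<integral>\<^sup>+\<xi>\<in>\<Omega>. ennreal (gradL_norm \<gamma> u \<xi> powr p * ln (R / rr \<xi>) powr (p + b)) \<partial>lborel)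
      = (\<integral>\<^sup>+\<xi>\<in>\<Omega>. ennreal ((rr \<xi> * gradL_norm \<gamma> u \<xi>) powr p * (ln R - ln (rr \<xi>)) powr (p + b)) \<partial>hmeas)"
proof -
  have [measurable]: "\<Omega> \<in> sets borel" using \<Omega> by simp
  have [measurable]: "u \<in> borel_measurable borel" "gradL_norm \<gamma> u \<in> borel_measurable borel"
    using C1_0_continuous[OF u \<Omega>] gradL_norm_borel[OF u \<Omega>]
    by (auto intro: borel_measurable_continuous_onI)
  have l: "ln (R / rr \<xi>) = ln R - ln (rr \<xi>)" if "rr \<xi> \<noteq> 0" for \<xi> :: "'n pt"
    using that R rr_nonneg[of \<xi>] by (simp add: ln_div less_le)
  show "(\<integral>\<^sup>+\<xi>\<in>\<Omega>. ennreal (\<bar>u \<xi>\<bar> powr p / rr \<xi> powr p * ln (R / rr \<xi>) powr b) \<partial>lborel)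
      = (\<integral>\<^sup>+\<xi>\<in>\<Omega>. ennreal (\<bar>u \<xi>\<bar> powr p * (ln R - ln (rr \<xi>)) powr b) \<partial>hmeas)"
  proof (rule set_nn_integral_lborel_eq_hmeas)
    show "\<bar>u \<xi>\<bar> powr p / rr \<xi> powr p * ln (R / rr \<xi>) powr b
        = rr \<xi> powr - (2 * real CARD('n)) * (\<bar>u \<xi>\<bar> powr p * (ln R - ln (rr \<xi>)) powr b)" for \<xi>
      by (cases "rr \<xi> = 0") (auto simp: l p powr_minus_divide)
  qed measurable
  show "(\<integral>\<^sup>+\<xi>\<in>\<Omega>. ennreal (gradL_norm \<gamma> u \<xi> powr p * ln (R / rr \<xi>) powr (p + b)) \<partial>lborel)
      = (\<integral>\<^sup>+\<xi>\<in>\<Omega>. ennreal ((rr \<xi> * gradL_norm \<gamma> u \<xi>) powr p * (ln R - ln (rr \<xi>)) powr (p + b)) \<partial>hmeas)"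
  proof (rule set_nn_integral_lborel_eq_hmeas)
    show "gradL_norm \<gamma> u \<xi> powr p * ln (R / rr \<xi>) powr (p + b)
        = rr \<xi> powr - (2 * real CARD('n)) * ((rr \<xi> * gradL_norm \<gamma> u \<xi>) powr p * (ln R - ln (rr \<xi>)) powr (p + b))" for \<xi>
      by (cases "rr \<xi> = 0") (auto simp: l p powr_mult powr_minus)
  qed measurable
qed

theorem hardy_power_weight:
  fixes \<Omega> :: "'n::finite pt set"
  assumes p: "1 < p" and \<Omega>: "open \<Omega>"
    and inner: "2 * real CARD('n) + \<beta> < 0 \<Longrightarrow> \<Omega> \<subseteq> {\<xi>. rr \<xi> \<noteq> 0}" and u: "u \<in> C1_0 \<Omega>"
  shows "ennreal ((\<bar>2 * real CARD('n) + \<beta>\<bar> / p) powr p) *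
           (\<integral>\<^sup>+\<xi>\<in>\<Omega>. ennreal (\<bar>u \<xi>\<bar> powr p * rr \<xi> powr \<beta>) \<partial>lborel)
         \<le> (\<integral>\<^sup>+\<xi>\<in>\<Omega>. ennreal (gradL_norm \<gamma> u \<xi> powr p * rr \<xi> powr (p + \<beta>)) \<partial>lborel)"
proof -
  define d where "d = (2 * real CARD('n) + \<beta>) / p"
  have pd: "p * d = 2 * real CARD('n) + \<beta>" using p by (simp add: d_def)
  have ad: "\<bar>2 * real CARD('n) + \<beta>\<bar> / p = \<bar>d\<bar>" using p by (simp add: d_def)
  have "compact (closure {\<xi>. u \<xi> \<noteq> 0})" using u by (auto simp: C1_0_def)
  then have "bounded (rr ` closure {\<xi>. u \<xi> \<noteq> 0})"
    by (intro compact_imp_bounded compact_continuous_image continuous_on_rr continuous_on_id)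
  then obtain B where B: "0 < B" "\<And>\<xi>. \<xi> \<in> closure {\<xi>. u \<xi> \<noteq> 0} \<Longrightarrow> rr \<xi> \<le> B"
    by (auto simp: bounded_pos)
  show ?thesis
    unfolding power_weight_hmeas[OF u \<Omega>] ad
  proof (rule hardy_weighted[where \<tau> = "\<lambda>s. s" and \<tau>' = "\<lambda>_. 1" and L = "ln (B + 1)" and
        V = "\<lambda>s. exp ((2 * real CARD('n) + \<beta>) * s)" and Z = "\<lambda>s. exp ((2 * real CARD('n) + \<beta>) * s)", OF p u \<Omega>])
    show "rr \<xi> < exp (ln (B + 1))" if "\<xi> \<in> closure {\<xi>. u \<xi> \<noteq> 0}" for \<xi>
      using B(1) B(2)[OF that] by simp
    show "\<Omega> \<subseteq> {\<xi>. rr \<xi> \<noteq> 0}" if "d < 0"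
      using that p by (intro inner) (simp add: mult_pos_neg flip: pd)
  qed (auto simp: pd)
qed

theorem hardy_power_weight_sharp:
  fixes \<Omega> :: "'n::finite pt set"
  assumes p: "1 < p" and \<gamma>: "0 < \<gamma>" and \<Omega>: "open \<Omega>"
    and \<rho>: "0 < \<rho>" and sub: "{\<xi>. 0 < rr \<xi> \<and> rr \<xi> < \<rho> \<and> \<bar>tc \<xi>\<bar> < \<rho>} \<subseteq> \<Omega>"
    and C: "(\<bar>2 * real CARD('n) + \<beta>\<bar> / p) powr p < C"
  shows "\<exists>u\<in>C1_0 \<Omega>. \<not> (ennreal C * (\<integral>\<^sup>+\<xi>\<in>\<Omega>. ennreal (\<bar>u \<xi>\<bar> powr p * rr \<xi> powr \<beta>) \<partial>lborel)
         \<le> (\<integral>\<^sup>+\<xi>\<in>\<Omega>. ennreal (gradL_norm \<gamma> u \<xi> powr p * rr \<xi> powr (p + \<beta>)) \<partial>lborel))"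
proof -
  define d where "d = (2 * real CARD('n) + \<beta>) / p"
  have pd: "p * d = 2 * real CARD('n) + \<beta>" using p by (simp add: d_def)
  have ad: "\<bar>2 * real CARD('n) + \<beta>\<bar> / p = \<bar>d\<bar>" using p by (simp add: d_def)
  \<comment> \<open>The identity serves as \<tau> on the whole line, so the bound
    \<open>L = 0\<close> chosen below is arbitrary.\<close>
  have "((\<lambda>s. exp (2 * \<gamma> * s) / 1) \<longlongrightarrow> 0) at_bot"
    using \<gamma> by real_asymp
  then have "\<exists>u\<in>C1_0 \<Omega>. \<not> ennreal C * (\<integral>\<^sup>+\<xi>\<in>\<Omega>. ennreal (\<bar>u \<xi>\<bar> powr p * exp ((2 * real CARD('n) + \<beta>) * ln (rr \<xi>))) \<partial>hmeas)
      \<le> (\<integral>\<^sup>+\<xi>\<in>\<Omega>. ennreal ((rr \<xi> * gradL_norm \<gamma> u \<xi>) powr p * exp ((2 * real CARD('n) + \<beta>) * ln (rr \<xi>))) \<partial>hmeas)"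
    using \<gamma> C unfolding ad
    by (intro hardy_weighted_sharp[where \<tau> = "\<lambda>s. s" and \<tau>' = "\<lambda>_. 1" and L = 0 and d = d and
        V = "\<lambda>s. exp ((2 * real CARD('n) + \<beta>) * s)" and Z = "\<lambda>s. exp ((2 * real CARD('n) + \<beta>) * s)", OF p _ _ _ _ _ _ _ _ \<rho> sub])
      (auto simp: pd filterlim_ident)
  then show ?thesis
    by (elim bexE, intro bexI) (simp_all add: power_weight_hmeas[OF _ \<Omega>])
qed

section \<open>The logarithmic substitution\<close>

context
  fixes R b p d :: real
  assumes R: "0 < R" and b: "b < - 1" and p: "0 < p" and d: "d = \<bar>b + 1\<bar> / p"
begin

text \<open>With \<sigma> = ln R - s and \<tau> = - ln \<sigma>, the relation p d = - (b + 1) gives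
  exp (p d \<tau>) = \<sigma>^(b + 1). The factors \<tau>' = 1 / \<sigma> and \<tau>'^(1 - p) =
  \<sigma>^(p - 1) then produce the exponents b and p + b.\<close>

lemma log_weight_substitution:
  assumes "s < ln R"
  shows "((\<lambda>s. - ln (ln R - s)) has_real_derivative 1 / (ln R - s)) (at s)"
    and "(ln R - s) powr b = exp (p * d * - ln (ln R - s)) * (1 / (ln R - s))"
    and "(ln R - s) powr (p + b) = exp (p * d * - ln (ln R - s)) * (1 / (ln R - s)) powr (1 - p)"
proof -
  define \<sigma> where "\<sigma> = ln R - s"
  have \<sigma>: "0 < \<sigma>" using assms by (simp add: \<sigma>_def)
  have E: "exp (p * d * - ln \<sigma>) = \<sigma> powr (b + 1)"
  proof -
    have "p * d = - (b + 1)" using p b by (simp add: d)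
    then have "p * d * - ln \<sigma> = (b + 1) * ln \<sigma>"
      by (simp only: mult_minus_left mult_minus_right minus_minus)
    then show ?thesis using \<sigma> by (simp add: powr_def)
  qed
  show "((\<lambda>s. - ln (ln R - s)) has_real_derivative 1 / (ln R - s)) (at s)"
    using assms by (auto intro!: derivative_eq_intros)
  show "(ln R - s) powr b = exp (p * d * - ln (ln R - s)) * (1 / (ln R - s))"
    using \<sigma> unfolding \<sigma>_def[symmetric] E by (simp add: powr_add)
  show "(ln R - s) powr (p + b) = exp (p * d * - ln (ln R - s)) * (1 / (ln R - s)) powr (1 - p)"
    using \<sigma> unfolding \<sigma>_def[symmetric] E
    by (simp add: powr_divide powr_add powr_diff)
qed

end

theorem hardy_log_weight:
  fixes u :: "'n::finite pt \<Rightarrow> real"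
  assumes R: "0 < R" and b: "b < - 1" and p: "p = 2 * real CARD('n)"
    and u: "u \<in> C1_0 {\<xi>. rr \<xi> < R}"
  shows "ennreal ((\<bar>b + 1\<bar> / p) powr p) *
      (\<integral>\<^sup>+\<xi>\<in>{\<xi>. rr \<xi> < R}. ennreal (\<bar>u \<xi>\<bar> powr p / rr \<xi> powr p * ln (R / rr \<xi>) powr b) \<partial>lborel)
    \<le> (\<integral>\<^sup>+\<xi>\<in>{\<xi>. rr \<xi> < R}. ennreal (gradL_norm \<gamma> u \<xi> powr p * ln (R / rr \<xi>) powr (p + b)) \<partial>lborel)"
proof -
  define d where "d = \<bar>b + 1\<bar> / p"
  have "1 \<le> real CARD('n)" by (simp add: Suc_le_eq)
  then have p1: "1 < p" unfolding p by linarith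
  have p0: "0 < p" using p1 by simp
  have d0: "0 \<le> d" using p0 by (simp add: d_def)
  have ad: "\<bar>b + 1\<bar> / p = \<bar>d\<bar>" using d0 by (simp only: d_def abs_of_nonneg)
  have \<Omega>: "open {\<xi> :: 'n pt. rr \<xi> < R}" by (intro open_Collect_less continuous_intros)
  note W = log_weight_substitution[OF R b p0 d_def]
  show ?thesis
    unfolding log_weight_hmeas[OF u \<Omega> p R] ad
  proof (rule hardy_weighted[where \<tau> = "\<lambda>s. - ln (ln R - s)" and \<tau>' = "\<lambda>s. 1 / (ln R - s)" and L = "ln R" and
        V = "\<lambda>s. (ln R - s) powr b" and Z = "\<lambda>s. (ln R - s) powr (p + b)", OF p1 u \<Omega> W(1) _ _ _ _ W(2) W(3)])
    show "rr \<xi> < exp (ln R)" if "\<xi> \<in> closure {\<xi>. u \<xi> \<noteq> 0}" for \<xi>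
      using u that R by (auto simp: C1_0_def)
  qed (use d0 in \<open>auto intro!: continuous_intros\<close>)
qed

theorem hardy_log_weight_sharp:
  assumes \<gamma>: "0 < \<gamma>" and R: "0 < R" and b: "b < - 1" and p: "p = 2 * real CARD('n::finite)"
    and C: "(\<bar>b + 1\<bar> / p) powr p < C"
  shows "\<exists>u\<in>C1_0 {\<xi> :: 'n pt. rr \<xi> < R}. \<not> (ennreal C *
      (\<integral>\<^sup>+\<xi>\<in>{\<xi>. rr \<xi> < R}. ennreal (\<bar>u \<xi>\<bar> powr p / rr \<xi> powr p * ln (R / rr \<xi>) powr b) \<partial>lborel)
    \<le> (\<integral>\<^sup>+\<xi>\<in>{\<xi>. rr \<xi> < R}. ennreal (gradL_norm \<gamma> u \<xi> powr p * ln (R / rr \<xi>) powr (p + b)) \<partial>lborel))"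
proof -
  define d where "d = \<bar>b + 1\<bar> / p"
  have "1 \<le> real CARD('n)" by (simp add: Suc_le_eq)
  then have p1: "1 < p" unfolding p by linarith
  have p0: "0 < p" using p1 by simp
  have d0: "0 \<le> d" using p0 by (simp add: d_def)
  have ad: "\<bar>b + 1\<bar> / p = \<bar>d\<bar>" using d0 by (simp only: d_def abs_of_nonneg)
  have \<Omega>: "open {\<xi> :: 'n pt. rr \<xi> < R}" by (intro open_Collect_less continuous_intros)
  note W = log_weight_substitution[OF R b p0 d_def]
  have "\<exists>u\<in>C1_0 {\<xi> :: 'n pt. rr \<xi> < R}. \<not> ennreal C *
      (\<integral>\<^sup>+\<xi>\<in>{\<xi>. rr \<xi> < R}. ennreal (\<bar>u \<xi>\<bar> powr p * (ln R - ln (rr \<xi>)) powr b) \<partial>hmeas)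
    \<le> (\<integral>\<^sup>+\<xi>\<in>{\<xi>. rr \<xi> < R}. ennreal ((rr \<xi> * gradL_norm \<gamma> u \<xi>) powr p * (ln R - ln (rr \<xi>)) powr (p + b)) \<partial>hmeas)"
  proof (rule hardy_weighted_sharp[where \<tau> = "\<lambda>s. - ln (ln R - s)" and \<tau>' = "\<lambda>s. 1 / (ln R - s)" and L = "ln R" and
        V = "\<lambda>s. (ln R - s) powr b" and Z = "\<lambda>s. (ln R - s) powr (p + b)", OF p1 _ W(1) _ _ W(2) W(3) _ _ R])
    show "filterlim (\<lambda>s. - ln (ln R - s)) at_bot at_bot" by real_asymp
    show "((\<lambda>s. exp (2 * \<gamma> * s) / (1 / (ln R - s))) \<longlongrightarrow> 0) at_bot" using \<gamma> by real_asymp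
    show "\<bar>d\<bar> powr p < C" using C by (simp only: ad)
  qed (use \<gamma> in \<open>auto intro!: continuous_intros\<close>)
  then show ?thesis
    by (elim bexE, intro bexI) (simp_all only: log_weight_hmeas[OF _ \<Omega> p R] simp_thms)
qed

theorem mainTheorem12:
  fixes \<gamma> \<beta> :: real
  assumes "\<gamma> \<ge> 1"
  shows
  \<comment> \<open>(1) weighted Hardy inequality\<close>
  "(\<forall>(p::real) (\<Omega>::('n::finite) pt set).
      1 < p \<and> open \<Omega> \<and> (2 * real CARD('n) + \<beta> < 0 \<longrightarrow> \<Omega> \<subseteq> {\<xi>. rr \<xi> \<noteq> 0}) \<longrightarrow>
      (\<forall>u\<in>C1_0 \<Omega>.
         ennreal ((\<bar>2 * real CARD('n) + \<beta>\<bar> / p) powr p) *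
           (\<integral>\<^sup>+\<xi>\<in>\<Omega>. ennreal (\<bar>u \<xi>\<bar> powr p * rr \<xi> powr \<beta>) \<partial>lborel)
         \<le> (\<integral>\<^sup>+\<xi>\<in>\<Omega>. ennreal (gradL_norm \<gamma> u \<xi> powr p * rr \<xi> powr (p + \<beta>)) \<partial>lborel)))
   \<and>
  \<comment> \<open>(1) particular case beta = -p\<close>
   (\<forall>(p::real) (\<Omega>::('n::finite) pt set).
      1 < p \<and> open \<Omega> \<and> (2 * real CARD('n) - p < 0 \<longrightarrow> \<Omega> \<subseteq> {\<xi>. rr \<xi> \<noteq> 0}) \<longrightarrow>
      (\<forall>u\<in>C1_0 \<Omega>.
         ennreal ((\<bar>2 * real CARD('n) - p\<bar> / p) powr p) *
           (\<integral>\<^sup>+\<xi>\<in>\<Omega>. ennreal (\<bar>u \<xi>\<bar> powr p / NN \<gamma> \<xi> powr p) \<partial>lborel)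
         \<le> ennreal ((\<bar>2 * real CARD('n) - p\<bar> / p) powr p) *
           (\<integral>\<^sup>+\<xi>\<in>\<Omega>. ennreal (\<bar>u \<xi>\<bar> powr p / rr \<xi> powr p) \<partial>lborel)
       \<and> ennreal ((\<bar>2 * real CARD('n) - p\<bar> / p) powr p) *
           (\<integral>\<^sup>+\<xi>\<in>\<Omega>. ennreal (\<bar>u \<xi>\<bar> powr p / rr \<xi> powr p) \<partial>lborel)
         \<le> (\<integral>\<^sup>+\<xi>\<in>\<Omega>. ennreal (gradL_norm \<gamma> u \<xi> powr p) \<partial>lborel)))
   \<and>
  \<comment> \<open>(1) sharpness\<close>
   (\<forall>(p::real) (\<Omega>::('n::finite) pt set) (\<rho>::real) (C::real).
      1 < p \<and> open \<Omega> \<and> (2 * real CARD('n) + \<beta> < 0 \<longrightarrow> \<Omega> \<subseteq> {\<xi>. rr \<xi> \<noteq> 0}) \<and>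
      \<rho> > 0 \<and> {\<xi>. 0 < rr \<xi> \<and> rr \<xi> < \<rho> \<and> \<bar>tc \<xi>\<bar> < \<rho>} \<subseteq> \<Omega> \<and>
      C > (\<bar>2 * real CARD('n) + \<beta>\<bar> / p) powr p \<longrightarrow>
      (\<exists>u\<in>C1_0 \<Omega>.
         \<not> (ennreal C * (\<integral>\<^sup>+\<xi>\<in>\<Omega>. ennreal (\<bar>u \<xi>\<bar> powr p * rr \<xi> powr \<beta>) \<partial>lborel)
            \<le> (\<integral>\<^sup>+\<xi>\<in>\<Omega>. ennreal (gradL_norm \<gamma> u \<xi> powr p * rr \<xi> powr (p + \<beta>)) \<partial>lborel))))
   \<and>
  \<comment> \<open>(2) critical case p = 2n, logarithmic weights\<close>
   (\<forall>(R::real) (b::real).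
      let p = 2 * real CARD('n); \<Omega> = {\<xi>::'n pt. rr \<xi> < R} in
      R > 0 \<and> b < -1 \<longrightarrow>
      (\<forall>u\<in>C1_0 \<Omega>.
         ennreal ((\<bar>b + 1\<bar> / p) powr p) *
           (\<integral>\<^sup>+\<xi>\<in>\<Omega>. ennreal (\<bar>u \<xi>\<bar> powr p / rr \<xi> powr p * ln (R / rr \<xi>) powr b) \<partial>lborel)
         \<le> (\<integral>\<^sup>+\<xi>\<in>\<Omega>. ennreal (gradL_norm \<gamma> u \<xi> powr p * ln (R / rr \<xi>) powr (p + b)) \<partial>lborel)))
   \<and>
  \<comment> \<open>(2) particular case b = -p\<close>
   (\<forall>(R::real).
      let p = 2 * real CARD('n); \<Omega> = {\<xi>::'n pt. rr \<xi> < R} in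
      R > 0 \<longrightarrow>
      (\<forall>u\<in>C1_0 \<Omega>.
         ennreal (((p - 1) / p) powr p) *
           (\<integral>\<^sup>+\<xi>\<in>\<Omega>. ennreal (\<bar>u \<xi>\<bar> powr p / (rr \<xi> * ln (R / rr \<xi>)) powr p) \<partial>lborel)
         \<le> (\<integral>\<^sup>+\<xi>\<in>\<Omega>. ennreal (gradL_norm \<gamma> u \<xi> powr p) \<partial>lborel)))
   \<and>
  \<comment> \<open>(2) sharpness\<close>
   (\<forall>(R::real) (b::real) (C::real).
      let p = 2 * real CARD('n); \<Omega> = {\<xi>::'n pt. rr \<xi> < R} in
      R > 0 \<and> b < -1 \<and> C > (\<bar>b + 1\<bar> / p) powr p \<longrightarrow>
      (\<exists>u\<in>C1_0 \<Omega>.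
         \<not> (ennreal C *
              (\<integral>\<^sup>+\<xi>\<in>\<Omega>. ennreal (\<bar>u \<xi>\<bar> powr p / rr \<xi> powr p * ln (R / rr \<xi>) powr b) \<partial>lborel)
            \<le> (\<integral>\<^sup>+\<xi>\<in>\<Omega>. ennreal (gradL_norm \<gamma> u \<xi> powr p * ln (R / rr \<xi>) powr (p + b)) \<partial>lborel))))"
proof (intro conjI allI)
  have \<gamma>0: "0 < \<gamma>" using assms by simp
  have n1: "1 \<le> real CARD('n)" by (simp add: Suc_le_eq)
  show "1 < p \<and> open \<Omega> \<and> (2 * real CARD('n) + \<beta> < 0 \<longrightarrow> \<Omega> \<subseteq> {\<xi>. rr \<xi> \<noteq> 0}) \<longrightarrow>
      (\<forall>u\<in>C1_0 \<Omega>.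
         ennreal ((\<bar>2 * real CARD('n) + \<beta>\<bar> / p) powr p) *
           (\<integral>\<^sup>+\<xi>\<in>\<Omega>. ennreal (\<bar>u \<xi>\<bar> powr p * rr \<xi> powr \<beta>) \<partial>lborel)
         \<le> (\<integral>\<^sup>+\<xi>\<in>\<Omega>. ennreal (gradL_norm \<gamma> u \<xi> powr p * rr \<xi> powr (p + \<beta>)) \<partial>lborel))"
    for p and \<Omega> :: "'n pt set"
    by (intro impI ballI hardy_power_weight) auto
  show "1 < p \<and> open \<Omega> \<and> (2 * real CARD('n) - p < 0 \<longrightarrow> \<Omega> \<subseteq> {\<xi>. rr \<xi> \<noteq> 0}) \<longrightarrow>
      (\<forall>u\<in>C1_0 \<Omega>.
         ennreal ((\<bar>2 * real CARD('n) - p\<bar> / p) powr p) *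
           (\<integral>\<^sup>+\<xi>\<in>\<Omega>. ennreal (\<bar>u \<xi>\<bar> powr p / NN \<gamma> \<xi> powr p) \<partial>lborel)
         \<le> ennreal ((\<bar>2 * real CARD('n) - p\<bar> / p) powr p) *
           (\<integral>\<^sup>+\<xi>\<in>\<Omega>. ennreal (\<bar>u \<xi>\<bar> powr p / rr \<xi> powr p) \<partial>lborel)
       \<and> ennreal ((\<bar>2 * real CARD('n) - p\<bar> / p) powr p) *
           (\<integral>\<^sup>+\<xi>\<in>\<Omega>. ennreal (\<bar>u \<xi>\<bar> powr p / rr \<xi> powr p) \<partial>lborel)
         \<le> (\<integral>\<^sup>+\<xi>\<in>\<Omega>. ennreal (gradL_norm \<gamma> u \<xi> powr p) \<partial>lborel))"
    for p and \<Omega> :: "'n pt set"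
  proof (intro impI ballI conjI mult_left_mono)
    fix u :: "'n pt \<Rightarrow> real"
    assume H: "1 < p \<and> open \<Omega> \<and> (2 * real CARD('n) - p < 0 \<longrightarrow> \<Omega> \<subseteq> {\<xi>. rr \<xi> \<noteq> 0})" and u: "u \<in> C1_0 \<Omega>"
    \<comment> \<open>The restriction to r > 0 matters: on the axis the right side is 0 by division
      by zero, while the left side can be positive for t \<noteq> 0.\<close>
    have "\<bar>u \<xi>\<bar> powr p / NN \<gamma> \<xi> powr p \<le> \<bar>u \<xi>\<bar> powr p / rr \<xi> powr p" if "0 < rr \<xi>" for \<xi>
      using that H rr_le_NN[OF \<gamma>0, of \<xi>] by (intro divide_left_mono powr_mono2) (auto intro!: mult_pos_pos)
    then show "(\<integral>\<^sup>+\<xi>\<in>\<Omega>. ennreal (\<bar>u \<xi>\<bar> powr p / NN \<gamma> \<xi> powr p) \<partial>lborel)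
        \<le> (\<integral>\<^sup>+\<xi>\<in>\<Omega>. ennreal (\<bar>u \<xi>\<bar> powr p / rr \<xi> powr p) \<partial>lborel)"
      using AE_rr_pos
      by (intro nn_integral_mono_AE) (auto elim!: eventually_mono intro!: mult_right_mono ennreal_leI)
    have "ennreal ((\<bar>2 * real CARD('n) + - p\<bar> / p) powr p) *
           (\<integral>\<^sup>+\<xi>\<in>\<Omega>. ennreal (\<bar>u \<xi>\<bar> powr p * rr \<xi> powr - p) \<partial>lborel)
         \<le> (\<integral>\<^sup>+\<xi>\<in>\<Omega>. ennreal (gradL_norm \<gamma> u \<xi> powr p * rr \<xi> powr (p + - p)) \<partial>lborel)"
      using H u by (intro hardy_power_weight) auto
    \<comment> \<open>The remaining factor \<open>rr \<xi> powr 0\<close> is 1 off the axis but 0 on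
      it, hence an inequality.\<close>
    also have "\<dots> \<le> (\<integral>\<^sup>+\<xi>\<in>\<Omega>. ennreal (gradL_norm \<gamma> u \<xi> powr p) \<partial>lborel)"
      by (intro nn_integral_mono mult_right_mono ennreal_leI) (auto simp: powr_def)
    finally show "ennreal ((\<bar>2 * real CARD('n) - p\<bar> / p) powr p) *
           (\<integral>\<^sup>+\<xi>\<in>\<Omega>. ennreal (\<bar>u \<xi>\<bar> powr p / rr \<xi> powr p) \<partial>lborel)
         \<le> (\<integral>\<^sup>+\<xi>\<in>\<Omega>. ennreal (gradL_norm \<gamma> u \<xi> powr p) \<partial>lborel)"
      by (simp add: powr_minus divide_inverse)
  qed auto
  show "1 < p \<and> open \<Omega> \<and> (2 * real CARD('n) + \<beta> < 0 \<longrightarrow> \<Omega> \<subseteq> {\<xi>. rr \<xi> \<noteq> 0}) \<and>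
      \<rho> > 0 \<and> {\<xi>. 0 < rr \<xi> \<and> rr \<xi> < \<rho> \<and> \<bar>tc \<xi>\<bar> < \<rho>} \<subseteq> \<Omega> \<and>
      C > (\<bar>2 * real CARD('n) + \<beta>\<bar> / p) powr p \<longrightarrow>
      (\<exists>u\<in>C1_0 \<Omega>.
         \<not> (ennreal C * (\<integral>\<^sup>+\<xi>\<in>\<Omega>. ennreal (\<bar>u \<xi>\<bar> powr p * rr \<xi> powr \<beta>) \<partial>lborel)
            \<le> (\<integral>\<^sup>+\<xi>\<in>\<Omega>. ennreal (gradL_norm \<gamma> u \<xi> powr p * rr \<xi> powr (p + \<beta>)) \<partial>lborel)))"
    for p \<rho> C and \<Omega> :: "'n pt set"
    by (intro impI, elim conjE, rule hardy_power_weight_sharp[OF _ \<gamma>0])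
  show "let p = 2 * real CARD('n); \<Omega> = {\<xi>::'n pt. rr \<xi> < R} in
      R > 0 \<and> b < -1 \<longrightarrow>
      (\<forall>u\<in>C1_0 \<Omega>.
         ennreal ((\<bar>b + 1\<bar> / p) powr p) *
           (\<integral>\<^sup>+\<xi>\<in>\<Omega>. ennreal (\<bar>u \<xi>\<bar> powr p / rr \<xi> powr p * ln (R / rr \<xi>) powr b) \<partial>lborel)
         \<le> (\<integral>\<^sup>+\<xi>\<in>\<Omega>. ennreal (gradL_norm \<gamma> u \<xi> powr p * ln (R / rr \<xi>) powr (p + b)) \<partial>lborel))" for R b
    unfolding Let_def by (intro impI ballI hardy_log_weight) auto
  show "let p = 2 * real CARD('n); \<Omega> = {\<xi>::'n pt. rr \<xi> < R} in
      R > 0 \<longrightarrow>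
      (\<forall>u\<in>C1_0 \<Omega>.
         ennreal (((p - 1) / p) powr p) *
           (\<integral>\<^sup>+\<xi>\<in>\<Omega>. ennreal (\<bar>u \<xi>\<bar> powr p / (rr \<xi> * ln (R / rr \<xi>)) powr p) \<partial>lborel)
         \<le> (\<integral>\<^sup>+\<xi>\<in>\<Omega>. ennreal (gradL_norm \<gamma> u \<xi> powr p) \<partial>lborel))" for R
    unfolding Let_def
  proof (intro impI ballI)
    fix u :: "'n pt \<Rightarrow> real"
    assume R: "0 < R" and u: "u \<in> C1_0 {\<xi>. rr \<xi> < R}"
    define p where "p = 2 * real CARD('n)"
    have p: "2 \<le> p" using n1 by (simp add: p_def)
    have "ennreal ((\<bar>- p + 1\<bar> / p) powr p) *
        (\<integral>\<^sup>+\<xi>\<in>{\<xi>. rr \<xi> < R}. ennreal (\<bar>u \<xi>\<bar> powr p / rr \<xi> powr p * ln (R / rr \<xi>) powr - p) \<partial>lborel)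
      \<le> (\<integral>\<^sup>+\<xi>\<in>{\<xi>. rr \<xi> < R}. ennreal (gradL_norm \<gamma> u \<xi> powr p * ln (R / rr \<xi>) powr (p + - p)) \<partial>lborel)"
      using p by (intro hardy_log_weight R u p_def) auto
    \<comment> \<open>The logarithm now has exponent 0; its power is 1, or 0 where the logarithm
      itself vanishes.\<close>
    also have "\<dots> \<le> (\<integral>\<^sup>+\<xi>\<in>{\<xi>. rr \<xi> < R}. ennreal (gradL_norm \<gamma> u \<xi> powr p) \<partial>lborel)"
      by (intro nn_integral_mono mult_right_mono ennreal_leI) (auto simp: powr_def)
    also have "\<bar>- p + 1\<bar> = p - 1" using p by simp
    finally show "ennreal (((2 * real CARD('n) - 1) / (2 * real CARD('n))) powr (2 * real CARD('n))) *
           (\<integral>\<^sup>+\<xi>\<in>{\<xi>. rr \<xi> < R}. ennreal (\<bar>u \<xi>\<bar> powr (2 * real CARD('n)) / (rr \<xi> * ln (R / rr \<xi>)) powr (2 * real CARD('n))) \<partial>lborel)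
         \<le> (\<integral>\<^sup>+\<xi>\<in>{\<xi>. rr \<xi> < R}. ennreal (gradL_norm \<gamma> u \<xi> powr (2 * real CARD('n))) \<partial>lborel)"
      unfolding p_def[symmetric] by (simp add: powr_mult powr_minus divide_inverse mult.assoc)
  qed
  show "let p = 2 * real CARD('n); \<Omega> = {\<xi>::'n pt. rr \<xi> < R} in
      R > 0 \<and> b < -1 \<and> C > (\<bar>b + 1\<bar> / p) powr p \<longrightarrow>
      (\<exists>u\<in>C1_0 \<Omega>.
         \<not> (ennreal C *
              (\<integral>\<^sup>+\<xi>\<in>\<Omega>. ennreal (\<bar>u \<xi>\<bar> powr p / rr \<xi> powr p * ln (R / rr \<xi>) powr b) \<partial>lborel)
            \<le> (\<integral>\<^sup>+\<xi>\<in>\<Omega>. ennreal (gradL_norm \<gamma> u \<xi> powr p * ln (R / rr \<xi>) powr (p + b)) \<partial>lborel)))" for R b C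
    unfolding Let_def by (intro impI, elim conjE, rule hardy_log_weight_sharp[OF \<gamma>0 _ _ refl])
qed

end
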